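(* Let $\Gamma$ be a finite abelian group and let $S\subseteq\Gamma$ with $0\notin S$. Then the mixed Cayley graph $\mathrm{Cay}(\Gamma,S)$ is HS-integral if and only if $S\setminus\overline{S}\in\mathbb{B}(\Gamma)$ and $\overline{S}\in\mathbb{E}(\Gamma)$.
   Context: $\Gamma$ is written additively, with identity $0$; for $x\in\Gamma$ and $k\in\mathbb{Z}$, $x^k$ denotes $kx$, and $-x$ is the inverse of $x$. For $S\subseteq\Gamma$ with $0\notin S$, put $S^{-1}=\{-s:s\in S\}$ and $\overline{S}=\{u\in S: -u\notin S\}$. A set $S$ is skew-symmetric if $-a\notin S$ for all $a\in S$. The mixed Cayley graph $\mathrm{Cay}(\Gamma,S)$ has vertex set $\Gamma$ and arc set $\{(a,b): b-a\in S\}$. For a mixed graph $G$, the Hermitian adjacency matrix of second kind $\mathcal{H}(G)=(h_{uv})$ is defined by $h_{uv}=1$ if both $(u,v)$ and $(v,u)$ are arcs, $h_{uv}=\frac{1+i\sqrt3}{2}$ if $(u,v)$ is an arc and $(v,u)$ is not, $h_{uv}=\frac{1-i\sqrt3}{2}$ if $(v,u)$ is an arc and $(u,v)$ is not, and $h_{uv}=0$ otherwise. $G$ is HS-integral if all eigenvalues of $\mathcal{H}(G)$ are integers. A simple graph, i.e. one with $S$ symmetric, is integral if all its adjacency eigenvalues are integers. $\mathbb{B}(\Gamma)$ is the Boolean algebra of subsets of $\Gamma$ generated by all subgroups of $\Gamma$ under finite unions, intersections and complements. Its atoms are the sets $[x]=\{y\in\Gamma:\langle y\rangle=\langle x\rangle\}$,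 and every element of $\mathbb{B}(\Gamma)$ is a union of such atoms. $\Gamma(3)$ is the set of $x\in\Gamma$ whose order is divisible by $3$. For $m\equiv0\pmod 3$, put $G^1_{m,3}(1)=\{k:1\le k\le m-1,\ \gcd(k,m)=1,\ k\equiv1\pmod3\}$. For $x\in\Gamma(3)$ with $\mathrm{ord}(x)=m$, put $\langle\!\langle x\rangle\!\rangle=\{x^k:k\in G^1_{m,3}(1)\}$. If $\Gamma(3)\neq\emptyset$, $\mathbb{E}(\Gamma)$ is the set of all skew-symmetric subsets of $\Gamma$ of the form $\langle\!\langle x_1\rangle\!\rangle\cup\cdots\cup\langle\!\langle x_k\rangle\!\rangle$ with $x_1,\dots,x_k\in\Gamma(3)$. If $\Gamma(3)=\emptyset$, then $\mathbb{E}(\Gamma)=\{\emptyset\}$. *)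

theory Defs
  imports
    Complex_Main
    "HOL-Algebra.Multiplicative_Group"
    "HOL-Number_Theory.Cong"
    "Graph_Theory.Pair_Digraph"
begin

text \<open>
  Groups are HOL-Algebra groups, hence written multiplicatively: \<open>b - a\<close> becomes
  \<open>b \<otimes> inv a\<close>, \<open>kx\<close> becomes \<open>x [^] k\<close> and \<open>0\<close> becomes \<open>\<one>\<close>.
\<close>

definition cayley_mixed_graph :: "('a, 'b) monoid_scheme \<Rightarrow> 'a set \<Rightarrow> 'a pair_pre_digraph" where
  "cayley_mixed_graph G S =
     \<lparr> pverts = carrier G,
       parcs = {(a, b). a \<in> carrier G \<and> b \<in> carrier G \<and> b \<otimes>\<^bsub>G\<^esub> inv\<^bsub>G\<^esub> a \<in> S} \<rparr>"

text \<open>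
  Matrices with rows and columns indexed by a finite vertex set \<open>V\<close> are functions of two
  arguments, of which only the values on \<open>V \<times> V\<close> matter; vectors likewise.
\<close>

definition hermitian_adjacency2 :: "'a pair_pre_digraph \<Rightarrow> 'a \<Rightarrow> 'a \<Rightarrow> complex" where
  "hermitian_adjacency2 D u v =
     (if (u, v) \<in> parcs D \<and> (v, u) \<in> parcs D then 1
      else if (u, v) \<in> parcs D \<and> (v, u) \<notin> parcs D then (1 + \<i> * complex_of_real (sqrt 3)) / 2
      else if (v, u) \<in> parcs D \<and> (u, v) \<notin> parcs D then (1 - \<i> * complex_of_real (sqrt 3)) / 2
      else 0)"

definition eigenvalue_on :: "'a set \<Rightarrow> ('a \<Rightarrow> 'a \<Rightarrow> complex) \<Rightarrow> complex \<Rightarrow> bool" where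
  "eigenvalue_on V M c \<longleftrightarrow>
     (\<exists>x. (\<exists>u\<in>V. x u \<noteq> 0) \<and> (\<forall>u\<in>V. (\<Sum>v\<in>V. M u v * x v) = c * x u))"

definition HS_integral :: "'a pair_pre_digraph \<Rightarrow> bool" where
  "HS_integral D \<longleftrightarrow>
     (\<forall>c. eigenvalue_on (pverts D) (hermitian_adjacency2 D) c \<longrightarrow> c \<in> \<int>)"

definition skew_part :: "('a, 'b) monoid_scheme \<Rightarrow> 'a set \<Rightarrow> 'a set" where
  "skew_part G S = {u \<in> S. inv\<^bsub>G\<^esub> u \<notin> S}"

definition skew_symmetric :: "('a, 'b) monoid_scheme \<Rightarrow> 'a set \<Rightarrow> bool" where
  "skew_symmetric G S \<longleftrightarrow> (\<forall>a\<in>S. inv\<^bsub>G\<^esub> a \<notin> S)"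

inductive_set subgroup_algebra :: "('a, 'b) monoid_scheme \<Rightarrow> 'a set set"
  for G :: "('a, 'b) monoid_scheme" where
  subgroup: "subgroup H G \<Longrightarrow> H \<in> subgroup_algebra G"
| compl: "A \<in> subgroup_algebra G \<Longrightarrow> carrier G - A \<in> subgroup_algebra G"
| union: "A \<in> subgroup_algebra G \<Longrightarrow> B \<in> subgroup_algebra G \<Longrightarrow> A \<union> B \<in> subgroup_algebra G"
| inter: "A \<in> subgroup_algebra G \<Longrightarrow> B \<in> subgroup_algebra G \<Longrightarrow> A \<inter> B \<in> subgroup_algebra G"

definition elements_order_dvd3 :: "('a, 'b) monoid_scheme \<Rightarrow> 'a set" where
  "elements_order_dvd3 G = {x \<in> carrier G. 3 dvd group.ord G x}"

definition units_1_mod_3 :: "nat \<Rightarrow> nat set" where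
  "units_1_mod_3 m = {k. 1 \<le> k \<and> k \<le> m - 1 \<and> gcd k m = 1 \<and> [k = 1] (mod 3)}"

definition class3 :: "('a, 'b) monoid_scheme \<Rightarrow> 'a \<Rightarrow> 'a set" where
  "class3 G x = {x [^]\<^bsub>G\<^esub> k | k. k \<in> units_1_mod_3 (group.ord G x)}"

text \<open>
  The empty union (\<open>X = {}\<close>) is allowed, so the empty set always belongs to the family.
\<close>

definition skew_class_unions :: "('a, 'b) monoid_scheme \<Rightarrow> 'a set set" where
  "skew_class_unions G =
     (if elements_order_dvd3 G = {} then {{}}
      else {A. skew_symmetric G A \<and>
               (\<exists>X. finite X \<and> X \<subseteq> elements_order_dvd3 G \<and> A = (\<Union>x\<in>X. class3 G x))})"

end

theory Submission
  imports Defs "HOL-Number_Theory.Number_Theory" "Jordan_Normal_Form.Char_Poly"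
begin

text \<open>
  The eigenvalues are the Fourier coefficients \<open>\<Sum> f s * \<chi> s\<close> of the weight function \<open>f\<close> on \<open>G\<close> with
  values \<open>0, 1, w, cnj w\<close>, where \<open>w = (1 + \<i>\<surd>3) / 2\<close>. With \<open>N\<close> the group order, they are all integers iff
  \<open>f (s\<^sup>k) = \<sigma>\<^sub>k (f s)\<close> for all \<open>k\<close> coprime to \<open>3N\<close>, where \<open>\<sigma>\<^sub>k\<close> is the identity or complex conjugation
  according to \<open>k\<close> modulo 3.

  If \<open>f\<close> is equivariant, then averaging over \<open>k\<close> expresses an eigenvalue through Ramanujan sums, so it is
  a rational number in \<open>\<int>[\<zeta>]\<close>, hence an integer. Conversely, let \<open>p\<close> be a prime not dividing \<open>3N\<close>. For an
  integral eigenvalue \<open>\<lambda>\<close>, the congruences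
  \<open>\<Sum> f (s\<^sup>p) * \<chi> (s\<^sup>p) = \<lambda> \<equiv> \<lambda>\<^sup>p \<equiv> \<Sum> \<sigma>\<^sub>p (f s) * \<chi> (s\<^sup>p)\<close> modulo \<open>p\<close>
  and Fourier inversion show that \<open>p\<close> divides \<open>N * (f (s\<^sup>p) - \<sigma>\<^sub>p (f s))\<close>. A nonzero difference of two
  weights has norm 1 or 3, so the difference vanishes; thus neither Galois theory nor the irreducibility
  of the cyclotomic polynomials is needed. Finally, equivariance for \<open>k \<equiv> 1\<close> modulo 3 says that the
  symmetric part of \<open>S\<close> is a union of classes \<open>[x]\<close> and its skew part a union of classes \<open>\<langle>\<langle>x\<rangle>\<rangle>\<close>.
\<close>

section \<open>Cyclotomic integers and Ramanujan sums\<close>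

definition cyclotomic_integers :: "nat \<Rightarrow> complex set" where
  "cyclotomic_integers n = range (\<lambda>p. poly (of_int_poly p) (cis (2 * pi / real n)))"

lemma cyclotomic_integers_add:
  assumes "x \<in> cyclotomic_integers n" "y \<in> cyclotomic_integers n"
  shows "x + y \<in> cyclotomic_integers n"
proof -
  obtain p q where "x = poly (of_int_poly p) (cis (2 * pi / real n))"
    "y = poly (of_int_poly q) (cis (2 * pi / real n))"
    using assms unfolding cyclotomic_integers_def by blast
  then have "x + y = poly (of_int_poly (p + q)) (cis (2 * pi / real n))"
    by (simp add: of_int_poly_hom.hom_add)
  then show ?thesis unfolding cyclotomic_integers_def by blast
qed

lemma cyclotomic_integers_mult:
  assumes "x \<in> cyclotomic_integers n" "y \<in> cyclotomic_integers n"
  shows "x * y \<in> cyclotomic_integers n"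
proof -
  obtain p q where "x = poly (of_int_poly p) (cis (2 * pi / real n))"
    "y = poly (of_int_poly q) (cis (2 * pi / real n))"
    using assms unfolding cyclotomic_integers_def by blast
  then have "x * y = poly (of_int_poly (p * q)) (cis (2 * pi / real n))"
    by (simp add: of_int_poly_hom.hom_mult)
  then show ?thesis unfolding cyclotomic_integers_def by blast
qed

lemma cyclotomic_integers_of_int: "of_int k \<in> cyclotomic_integers n"
proof -
  have "of_int k = poly (of_int_poly [:k:]) (cis (2 * pi / real n))"
    by (cases "k = 0") auto
  then show ?thesis unfolding cyclotomic_integers_def by blast
qed

lemma cyclotomic_integers_of_nat: "of_nat k \<in> cyclotomic_integers n"
  using cyclotomic_integers_of_int[of "int k"] by simp

lemma cyclotomic_integers_0: "0 \<in> cyclotomic_integers n"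
  using cyclotomic_integers_of_int[of 0] by simp

lemma cyclotomic_integers_1: "1 \<in> cyclotomic_integers n"
  using cyclotomic_integers_of_int[of 1] by simp

lemma cyclotomic_integers_uminus:
  "x \<in> cyclotomic_integers n \<Longrightarrow> - x \<in> cyclotomic_integers n"
  using cyclotomic_integers_mult[OF cyclotomic_integers_of_int[of "-1"]] by simp

lemma cyclotomic_integers_diff:
  "x \<in> cyclotomic_integers n \<Longrightarrow> y \<in> cyclotomic_integers n \<Longrightarrow> x - y \<in> cyclotomic_integers n"
  using cyclotomic_integers_add[OF _ cyclotomic_integers_uminus] by fastforce

lemma cyclotomic_integers_power:
  "x \<in> cyclotomic_integers n \<Longrightarrow> x ^ k \<in> cyclotomic_integers n"
  by (induction k) (auto intro: cyclotomic_integers_1 cyclotomic_integers_mult)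

lemma cyclotomic_integers_sum:
  "(\<And>i. i \<in> A \<Longrightarrow> g i \<in> cyclotomic_integers n) \<Longrightarrow> sum g A \<in> cyclotomic_integers n"
  by (induction A rule: infinite_finite_induct)
     (auto intro: cyclotomic_integers_0 cyclotomic_integers_add)

lemma root_of_unity_in_cyclotomic_integers:
  assumes "n > 0" "z ^ n = 1"
  shows "z \<in> cyclotomic_integers n"
proof -
  obtain k where "z = cis (2 * pi * real k / real n)"
    using bij_betw_roots_unity[OF assms(1)] assms(2) unfolding bij_betw_def by blast
  then have "z = cis (2 * pi / real n) ^ k"
    by (simp add: DeMoivre mult_ac)
  moreover have "cis (2 * pi / real n) = poly (of_int_poly [:0, 1:]) (cis (2 * pi / real n))"
    by simp
  then have "cis (2 * pi / real n) \<in> cyclotomic_integers n"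
    unfolding cyclotomic_integers_def by blast
  ultimately show ?thesis by (simp add: cyclotomic_integers_power)
qed

text \<open>
  An element \<open>\<Sum> a\<^sub>k \<zeta>\<^sup>k\<close> of \<open>\<int>[\<zeta>]\<close> is an eigenvalue of an integral circulant matrix, with
  eigenvector \<open>(1, \<zeta>, \<zeta>\<^sup>2, \<dots>)\<close>.
\<close>

lemma cyclotomic_integers_algebraic_int:
  assumes "n > 0" "x \<in> cyclotomic_integers n"
  shows "algebraic_int x"
proof -
  define \<zeta> where "\<zeta> = cis (2 * pi / real n)"
  have zn: "\<zeta> ^ n = 1"
    using assms(1) by (simp add: \<zeta>_def DeMoivre)
  have zmod: "\<zeta> ^ k = \<zeta> ^ (k mod n)" for k
  proof -
    have "\<zeta> ^ k = \<zeta> ^ (n * (k div n) + k mod n)" by simp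
    also have "\<dots> = \<zeta> ^ (k mod n)" unfolding power_add power_mult zn by simp
    finally show ?thesis .
  qed
  obtain p where p: "x = poly (of_int_poly p) \<zeta>"
    using assms(2) unfolding cyclotomic_integers_def \<zeta>_def by blast
  define c where "c = coeff p"
  have x: "x = (\<Sum>k\<le>degree p. of_int (c k) * \<zeta> ^ k)"
    unfolding p poly_altdef c_def by (simp add: degree_map_poly coeff_map_poly)
  define C :: "int mat" where
    "C = mat n n (\<lambda>(i, l). \<Sum>k\<in>{k. k \<le> degree p \<and> (k + i) mod n = l}. c k)"
  have C: "C \<in> carrier_mat n n" unfolding C_def by simp
  let ?h = "map_mat (of_int :: int \<Rightarrow> complex)"
  define v where "v = vec n (\<lambda>i. \<zeta> ^ i)"
  have "row (?h C) i \<bullet> v = x * \<zeta> ^ i" if i: "i < n" for i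
  proof -
    have "row (?h C) i \<bullet> v =
        (\<Sum>l<n. (\<Sum>k\<in>{k. k \<le> degree p \<and> (k + i) mod n = l}. of_int (c k)) * \<zeta> ^ l)"
      using i unfolding scalar_prod_def v_def C_def by (simp add: atLeast0LessThan)
    also have "\<dots> = (\<Sum>l<n. \<Sum>k\<in>{k\<in>{..degree p}. (k + i) mod n = l}. of_int (c k) * \<zeta> ^ ((k + i) mod n))"
      unfolding sum_distrib_right by (intro sum.cong refl) auto
    also have "\<dots> = (\<Sum>k\<le>degree p. of_int (c k) * \<zeta> ^ ((k + i) mod n))"
      using assms(1) by (intro sum.group) auto
    also have "\<dots> = x * \<zeta> ^ i"
      unfolding x sum_distrib_right
      by (intro sum.cong refl) (metis zmod power_add mult.assoc)
    finally show ?thesis .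
  qed
  then have "?h C *\<^sub>v v = x \<cdot>\<^sub>v v"
    using C by (intro eq_vecI) (auto simp: v_def)
  moreover have "v \<noteq> 0\<^sub>v n"
  proof
    assume "v = 0\<^sub>v n"
    then have "v $ 0 = 0" using assms(1) by simp
    then show False using assms(1) by (simp add: v_def)
  qed
  ultimately have "eigenvalue (?h C) x"
    using C unfolding eigenvalue_def eigenvector_def v_def by (intro exI[of _ v]) (auto simp: v_def)
  then have "poly (char_poly (?h C)) x = 0"
    using C by (subst (asm) eigenvalue_root_char_poly[where n = n]) auto
  then have "poly (of_int_poly (char_poly C)) x = 0"
    using of_int_hom.char_poly_hom[OF C] by metis
  moreover have "lead_coeff (char_poly C) = 1"
    using degree_monic_char_poly[OF C] by simp
  ultimately show ?thesis
    unfolding algebraic_int_altdef_ipoly by blast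
qed

corollary cyclotomic_integers_Rats_imp_Ints:
  assumes "n > 0" "x \<in> cyclotomic_integers n" "x \<in> \<rat>"
  shows "x \<in> \<int>"
  using rational_algebraic_int_is_int cyclotomic_integers_algebraic_int assms by blast

definition cyclotomic_multiples :: "nat \<Rightarrow> nat \<Rightarrow> complex set" where
  "cyclotomic_multiples n p = (\<lambda>x. of_nat p * x) ` cyclotomic_integers n"

lemma cyclotomic_multiplesI:
  "x = of_nat p * y \<Longrightarrow> y \<in> cyclotomic_integers n \<Longrightarrow> x \<in> cyclotomic_multiples n p"
  unfolding cyclotomic_multiples_def by blast

lemma cyclotomic_multiples_add:
  assumes "x \<in> cyclotomic_multiples n p" "y \<in> cyclotomic_multiples n p"
  shows "x + y \<in> cyclotomic_multiples n p"
proof -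
  obtain a b where "a \<in> cyclotomic_integers n" "b \<in> cyclotomic_integers n"
    "x = of_nat p * a" "y = of_nat p * b"
    using assms unfolding cyclotomic_multiples_def by blast
  then show ?thesis
    by (intro cyclotomic_multiplesI[of _ _ "a + b"]) (auto simp: ring_distribs cyclotomic_integers_add)
qed

lemma cyclotomic_multiples_mult:
  assumes "x \<in> cyclotomic_multiples n p" "y \<in> cyclotomic_integers n"
  shows "x * y \<in> cyclotomic_multiples n p"
proof -
  obtain a where "a \<in> cyclotomic_integers n" "x = of_nat p * a"
    using assms unfolding cyclotomic_multiples_def by blast
  then show ?thesis
    using assms(2) by (intro cyclotomic_multiplesI[of _ _ "a * y"]) (auto simp: cyclotomic_integers_mult)
qed

lemma cyclotomic_multiples_uminus:
  "x \<in> cyclotomic_multiples n p \<Longrightarrow> - x \<in> cyclotomic_multiples n p"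
  using cyclotomic_multiples_mult[OF _ cyclotomic_integers_of_int[of "-1"]] by fastforce

lemma cyclotomic_multiples_diff:
  "x \<in> cyclotomic_multiples n p \<Longrightarrow> y \<in> cyclotomic_multiples n p \<Longrightarrow> x - y \<in> cyclotomic_multiples n p"
  using cyclotomic_multiples_add[OF _ cyclotomic_multiples_uminus] by fastforce

lemma cyclotomic_multiples_0: "0 \<in> cyclotomic_multiples n p"
  by (rule cyclotomic_multiplesI[of _ _ 0]) (auto intro: cyclotomic_integers_0)

lemma cyclotomic_multiples_sum:
  "(\<And>i. i \<in> A \<Longrightarrow> g i \<in> cyclotomic_multiples n p) \<Longrightarrow> sum g A \<in> cyclotomic_multiples n p"
  by (induction A rule: infinite_finite_induct)
     (auto intro: cyclotomic_multiples_0 cyclotomic_multiples_add)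

lemma freshmans_dream_cyclotomic:
  assumes "prime p" "x \<in> cyclotomic_integers n" "y \<in> cyclotomic_integers n"
  shows "(x + y) ^ p - (x ^ p + y ^ p) \<in> cyclotomic_multiples n p"
proof -
  have p: "p > 0" using assms(1) prime_gt_0_nat by blast
  have "{..p} = insert 0 (insert p {0<..<p})" using p by auto
  then have "(x + y) ^ p - (x ^ p + y ^ p) =
      (\<Sum>k\<in>{0<..<p}. of_nat (p choose k) * x ^ k * y ^ (p - k))"
    unfolding binomial_ring using p by simp
  also have "\<dots> \<in> cyclotomic_multiples n p"
  proof (rule cyclotomic_multiples_sum)
    fix k assume k: "k \<in> {0<..<p}"
    then have "p dvd (p choose k)"
      using assms(1) by (intro dvd_choose_prime) auto
    then obtain c where "p choose k = p * c" by blast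
    then show "of_nat (p choose k) * x ^ k * y ^ (p - k) \<in> cyclotomic_multiples n p"
      using assms(2,3)
      by (intro cyclotomic_multiplesI[of _ _ "of_nat c * x ^ k * y ^ (p - k)"])
         (auto intro!: cyclotomic_integers_mult cyclotomic_integers_power cyclotomic_integers_of_nat)
  qed
  finally show ?thesis .
qed

lemma freshmans_dream_cyclotomic_sum:
  assumes "prime p" "finite A" "\<And>i. i \<in> A \<Longrightarrow> g i \<in> cyclotomic_integers n"
  shows "(\<Sum>i\<in>A. g i) ^ p - (\<Sum>i\<in>A. g i ^ p) \<in> cyclotomic_multiples n p"
  using assms(2,3)
proof (induction A)
  case empty
  then show ?case using assms(1) prime_gt_0_nat[of p] by (simp add: cyclotomic_multiples_0 power_0_left)
next
  case (insert a A)
  have "(\<Sum>i\<in>insert a A. g i) ^ p - (\<Sum>i\<in>insert a A. g i ^ p) =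
      ((g a + sum g A) ^ p - (g a ^ p + sum g A ^ p)) + (sum g A ^ p - (\<Sum>i\<in>A. g i ^ p))"
    using insert.hyps by simp
  also have "\<dots> \<in> cyclotomic_multiples n p"
    using insert by (intro cyclotomic_multiples_add freshmans_dream_cyclotomic
        assms(1) cyclotomic_integers_sum) auto
  finally show ?case .
qed

lemma fermat_little_cyclotomic:
  assumes "prime p" "x \<in> \<int>"
  shows "x ^ p - x \<in> cyclotomic_multiples n p"
proof -
  obtain k where k: "x = of_int k" using assms(2) Ints_cases by blast
  have p: "p > 0" using assms(1) prime_gt_0_nat by blast
  have "[k ^ p = k] (mod int p)"
  proof (cases "int p dvd k")
    case True
    then show ?thesis using p by (simp add: cong_def mod_eq_0_iff_dvd dvd_power_le dvd_trans[OF _ dvd_power])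
  next
    case False
    then have "coprime k (int p)"
      using assms(1) by (metis coprime_commute prime_imp_coprime prime_nat_int_transfer)
    then have "[k ^ totient p = 1] (mod int p)"
      using p residues.euler_theorem[of "int p" k] assms(1) prime_gt_1_nat[of p]
      by (simp add: residues_def)
    then have "[k * k ^ (p - 1) = k * 1] (mod int p)"
      using assms(1) by (intro cong_scalar_left) (simp add: totient_prime)
    then show ?thesis using p by (simp flip: power_Suc)
  qed
  then obtain c where "k ^ p - k = int p * c" by (auto simp: cong_iff_dvd_diff)
  then have "x ^ p - x = of_nat p * of_int c"
    unfolding k by (metis of_int_diff of_int_mult of_int_of_nat_eq of_int_power)
  then show ?thesis by (rule cyclotomic_multiplesI) (rule cyclotomic_integers_of_int)
qed

lemma sum_powers_root_of_unity:
  fixes z :: complex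
  assumes "z ^ m = 1"
  shows "(\<Sum>k<m. z ^ k) = (if z = 1 then of_nat m else 0)"
  using geometric_sum[of z m] assms by auto

lemma ramanujan_sum_Ints:
  fixes z :: complex
  assumes "m > 0" "z ^ m = 1"
  shows "(\<Sum>k\<in>totatives m. z ^ k) \<in> \<int>"
  using assms
proof (induction m arbitrary: z rule: less_induct)
  case (less m)
  have "(\<Sum>k\<in>{0<..m}. z ^ k) = (\<Sum>d | d dvd m. \<Sum>k\<in>{k\<in>{0<..m}. gcd k m = d}. z ^ k)"
    using less.prems(1) by (intro sum.group[symmetric]) auto
  also have "\<dots> = (\<Sum>d | d dvd m. \<Sum>k\<in>totatives (m div d). (z ^ d) ^ k)"
  proof (rule sum.cong[OF refl])
    fix d assume "d \<in> {d. d dvd m}"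
    then show "(\<Sum>k\<in>{k\<in>{0<..m}. gcd k m = d}. z ^ k) = (\<Sum>k\<in>totatives (m div d). (z ^ d) ^ k)"
      using sum.reindex_bij_betw[OF bij_betw_totatives_gcd_eq[of d m], of "\<lambda>k. z ^ k"] less.prems(1)
      by (simp add: power_mult mult.commute[of _ d])
  qed
  also have "{d. d dvd m} = insert 1 ({d. d dvd m} - {1})" by auto
  also have "(\<Sum>d\<in>\<dots>. \<Sum>k\<in>totatives (m div d). (z ^ d) ^ k) =
      (\<Sum>k\<in>totatives m. z ^ k) + (\<Sum>d\<in>{d. d dvd m} - {1}. \<Sum>k\<in>totatives (m div d). (z ^ d) ^ k)"
    using less.prems(1) by (subst sum.insert) auto
  finally have "(\<Sum>k\<in>totatives m. z ^ k) =
      (\<Sum>k\<in>{0<..m}. z ^ k) - (\<Sum>d\<in>{d. d dvd m} - {1}. \<Sum>k\<in>totatives (m div d). (z ^ d) ^ k)"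
    by simp
  moreover have "(\<Sum>k\<in>{0<..m}. z ^ k) \<in> \<int>"
  proof -
    have "(\<Sum>k\<in>{0<..m}. z ^ k) = (\<Sum>k<m. z ^ Suc k)"
      by (rule sum.reindex_bij_witness[of _ Suc "\<lambda>k. k - 1"]) auto
    also have "\<dots> = z * (\<Sum>k<m. z ^ k)" by (simp add: sum_distrib_left)
    also have "\<dots> \<in> \<int>"
      using sum_powers_root_of_unity[OF less.prems(2)] by auto
    finally show ?thesis .
  qed
  moreover have "(\<Sum>k\<in>totatives (m div d). (z ^ d) ^ k) \<in> \<int>" if d: "d \<in> {d. d dvd m} - {1}" for d
  proof (rule less.IH)
    have "d > 0" using d less.prems(1) by (auto intro: Nat.gr0I)
    then show "m div d < m" using d less.prems(1) by auto
    show "0 < m div d" using d less.prems(1) by (auto simp: div_greater_zero_iff dvd_imp_le intro: Nat.gr0I)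
    show "(z ^ d) ^ (m div d) = 1"
      using d less.prems(2) by (simp flip: power_mult)
  qed
  then have "(\<Sum>d\<in>{d. d dvd m} - {1}. \<Sum>k\<in>totatives (m div d). (z ^ d) ^ k) \<in> \<int>"
    by (rule Ints_sum)
  ultimately show ?case by (metis Ints_diff)
qed

lemma ex_cong_coprime:
  fixes k m L :: nat
  assumes "coprime k m" "L > 0"
  obtains k' where "[k' = k] (mod m)" "coprime k' L"
proof
  define t where "t = \<Prod>{q. prime q \<and> q dvd L \<and> \<not> q dvd k}"
  have fin: "finite {q. prime q \<and> q dvd L \<and> \<not> q dvd k}"
    by (rule finite_subset[of _ "{..L}"]) (use assms(2) dvd_imp_le in auto)
  show "[k + m * t = k] (mod m)" by (simp add: cong_def)
  show "coprime (k + m * t) L"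
  proof (rule ccontr)
    assume "\<not> coprime (k + m * t) L"
    then have "gcd (k + m * t) L \<noteq> 1" using coprime_iff_gcd_eq_1 by blast
    then obtain q where "prime q" "q dvd gcd (k + m * t) L"
      using prime_factor_nat by blast
    then have q: "prime q" "q dvd k + m * t" "q dvd L" by (simp_all only: gcd_greatest_iff)
    show False
    proof (cases "q dvd k")
      case True
      then have "q dvd m * t" using q(2) by (simp add: dvd_add_right_iff)
      moreover have "\<not> q dvd m" using True q(1) assms(1) using coprime_common_divisor not_prime_unit by blast
      ultimately have "q dvd t" using q(1) by (simp add: prime_dvd_mult_iff)
      then obtain r where "prime r" "\<not> r dvd k" "q dvd r"
        unfolding t_def using q(1) fin by (subst (asm) prime_dvd_prod_iff) auto
      then show False using True q(1) by (metis primes_dvd_imp_eq)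
    next
      case False
      then have "q dvd t" unfolding t_def using q fin by (intro dvd_prodI) auto
      then show False using q(2) False by (simp add: dvd_add_left_iff)
    qed
  qed
qed

section \<open>Characters of finite abelian groups\<close>

definition characters :: "('a, 'b) monoid_scheme \<Rightarrow> ('a \<Rightarrow> complex) set" where
  "characters G = {\<chi> \<in> extensional (carrier G). \<chi> \<one>\<^bsub>G\<^esub> = 1 \<and>
     (\<forall>x\<in>carrier G. \<forall>y\<in>carrier G. \<chi> (x \<otimes>\<^bsub>G\<^esub> y) = \<chi> x * \<chi> y)}"

locale finite_comm_group = comm_group +
  assumes finite_carrier: "finite (carrier G)"
begin

lemma order_pos: "Coset.order G > 0"
  using finite_carrier one_closed unfolding Coset.order_def by (auto simp: card_gt_0_iff)

lemma char_one: "\<chi> \<in> characters G \<Longrightarrow> \<chi> \<one> = 1"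
  by (simp add: characters_def)

lemma char_mult:
  "\<chi> \<in> characters G \<Longrightarrow> x \<in> carrier G \<Longrightarrow> y \<in> carrier G \<Longrightarrow> \<chi> (x \<otimes> y) = \<chi> x * \<chi> y"
  by (simp add: characters_def)

lemma char_pow:
  "\<chi> \<in> characters G \<Longrightarrow> x \<in> carrier G \<Longrightarrow> \<chi> (x [^] (k::nat)) = \<chi> x ^ k"
  by (induction k) (auto simp: char_one char_mult)

lemma char_inv:
  "\<chi> \<in> characters G \<Longrightarrow> x \<in> carrier G \<Longrightarrow> \<chi> (inv x) * \<chi> x = 1"
  by (metis char_mult char_one inv_closed l_inv)

lemma char_pow_order: "\<chi> \<in> characters G \<Longrightarrow> x \<in> carrier G \<Longrightarrow> \<chi> x ^ Coset.order G = 1"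
  by (metis char_one char_pow pow_order_eq_1)

lemma char_neq_0: "\<chi> \<in> characters G \<Longrightarrow> x \<in> carrier G \<Longrightarrow> \<chi> x \<noteq> 0"
  using char_inv by fastforce

lemma restrict_in_characters:
  assumes "c \<one> = 1" "\<And>x y. x \<in> carrier G \<Longrightarrow> y \<in> carrier G \<Longrightarrow> c (x \<otimes> y) = c x * c y"
  shows "restrict c (carrier G) \<in> characters G"
  using assms by (simp add: characters_def)

lemma char_times_char:
  assumes "\<chi> \<in> characters G" "\<psi> \<in> characters G"
  shows "(\<lambda>x\<in>carrier G. \<chi> x * \<psi> x) \<in> characters G"
  using assms by (intro restrict_in_characters) (auto simp: char_one char_mult)

lemma char_comp_inv:
  assumes "\<chi> \<in> characters G"
  shows "(\<lambda>x\<in>carrier G. \<chi> (inv x)) \<in> characters G"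
  using assms by (intro restrict_in_characters) (auto simp: char_one char_mult inv_mult)

lemma finite_characters: "finite (characters G)"
proof (rule finite_subset)
  show "characters G \<subseteq> (carrier G \<rightarrow>\<^sub>E {z. z ^ Coset.order G = 1})"
    by (auto simp: PiE_def characters_def Pi_def intro: char_pow_order[unfolded characters_def])
  show "finite (carrier G \<rightarrow>\<^sub>E {z::complex. z ^ Coset.order G = 1})"
    using finite_carrier order_pos by (intro finite_PiE finite_roots_unity) auto
qed

lemma sum_translate:
  "g \<in> carrier G \<Longrightarrow> (\<Sum>z\<in>carrier G. F (g \<otimes> z)) = (\<Sum>z\<in>carrier G. F z)"
  by (rule sum.reindex_bij_witness[of _ "\<lambda>z. inv g \<otimes> z" "\<lambda>z. g \<otimes> z"])
     (auto simp: m_assoc[symmetric])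

lemma sum_inv: "(\<Sum>z\<in>carrier G. F (inv z)) = (\<Sum>z\<in>carrier G. F z)"
  by (rule sum.reindex_bij_witness[of _ "\<lambda>z. inv z" "\<lambda>z. inv z"]) auto

lemma pow_cong:
  assumes "x \<in> carrier G" "[j = k] (mod ord x)"
  shows "x [^] j = x [^] (k::nat)"
proof -
  have "int (ord x) dvd int k - int j"
    using assms(2) by (metis cong_iff_dvd_diff cong_int_iff cong_sym)
  then have "x [^] int j = x [^] int k"
    using int_pow_eq[OF assms(1)] by simp
  then show ?thesis by (simp add: int_pow_int)
qed

lemma ex_pow_inverse:
  assumes "coprime k L" "Coset.order G dvd L" "L > 0"
  obtains l :: nat where "coprime l L" "[k * l = 1] (mod L)"
    "\<And>x. x \<in> carrier G \<Longrightarrow> (x [^] (k::nat)) [^] l = x"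
proof -
  obtain l where l: "[k * l = 1] (mod L)"
    using cong_solve_coprime_nat[OF assms(1)] by auto
  show thesis
  proof (rule that[OF _ l])
    have "coprime (k * l) L" using cong_imp_coprime[OF cong_sym[OF l]] by simp
    then show "coprime l L" by simp
    fix x assume x: "x \<in> carrier G"
    then have "ord x dvd L" using ord_dvd_group_order assms(2) dvd_trans by blast
    then have "[k * l = 1] (mod ord x)" using l cong_dvd_modulus_nat by blast
    then have "x [^] (k * l) = x [^] (1::nat)" using x by (rule pow_cong[rotated])
    then show "(x [^] k) [^] l = x" using x by (simp add: nat_pow_pow)
  qed
qed

lemma sum_pow:
  assumes "coprime k (Coset.order G)"
  shows "(\<Sum>z\<in>carrier G. F (z [^] (k::nat))) = (\<Sum>z\<in>carrier G. F z)"
proof -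
  obtain l where "\<And>x. x \<in> carrier G \<Longrightarrow> (x [^] (k::nat)) [^] (l::nat) = x"
    using ex_pow_inverse[OF assms] order_pos by auto
  moreover from this have "\<And>x. x \<in> carrier G \<Longrightarrow> (x [^] l) [^] k = x"
    by (simp add: nat_pow_pow mult.commute)
  ultimately show ?thesis
    by (intro sum.reindex_bij_witness[of _ "\<lambda>z. z [^] l" "\<lambda>z. z [^] k"]) auto
qed

text \<open>
  Averaging the translates of \<open>\<phi>\<close> by the powers of \<open>g\<close> against the \<open>n\<close>-th roots of unity decomposes
  \<open>\<phi>\<close> into eigenvectors of the translation by \<open>g\<close>.
\<close>

lemma exists_translation_eigenvector:
  assumes "g \<in> carrier G" "\<exists>z\<in>carrier G. \<phi> z \<noteq> (0::complex)"
  obtains c where "\<exists>z\<in>carrier G. (\<Sum>i<Coset.order G. c ^ i * \<phi> (g [^] i \<otimes> z)) \<noteq> 0" "c ^ Coset.order G = 1"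
proof -
  define n where "n = Coset.order G"
  have n: "n > 0" unfolding n_def by (rule order_pos)
  obtain z where z: "z \<in> carrier G" "\<phi> z \<noteq> 0" using assms(2) by blast
  define \<zeta> where "\<zeta> = cis (2 * pi / real n)"
  have zn: "\<zeta> ^ n = 1"
    using n by (simp add: \<zeta>_def DeMoivre)
  have prim: "\<zeta> ^ i \<noteq> 1" if "0 < i" "i < n" for i
  proof
    assume "\<zeta> ^ i = 1"
    moreover have "inj_on (\<lambda>k. cis (2 * pi * real k / real n)) {..<n}"
      using bij_betw_roots_unity[OF n] by (rule bij_betw_imp_inj_on)
    moreover have "\<zeta> ^ k = cis (2 * pi * real k / real n)" for k
      by (simp add: \<zeta>_def DeMoivre mult_ac)
    ultimately have "i = 0"
      using that n by (auto dest: inj_onD[of _ _ i 0])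
    then show False using that by simp
  qed
  have "(\<Sum>j<n. \<Sum>i<n. (\<zeta> ^ j) ^ i * \<phi> (g [^] i \<otimes> z)) = (\<Sum>i<n. (\<Sum>j<n. (\<zeta> ^ i) ^ j) * \<phi> (g [^] i \<otimes> z))"
    unfolding sum_distrib_right
    by (subst sum.swap) (simp flip: power_mult add: mult.commute)
  also have "\<dots> = (\<Sum>i<n. if i = 0 then of_nat n * \<phi> z else 0)"
  proof (rule sum.cong[OF refl])
    fix i assume "i \<in> {..<n}"
    moreover have "(\<zeta> ^ i) ^ n = 1" using zn by (simp add: power_mult[symmetric] mult.commute[of i] power_mult)
    ultimately show "(\<Sum>j<n. (\<zeta> ^ i) ^ j) * \<phi> (g [^] i \<otimes> z) = (if i = 0 then of_nat n * \<phi> z else 0)"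
      using sum_powers_root_of_unity[of "\<zeta> ^ i" n] prim[of i] z(1) by auto
  qed
  also have "\<dots> = of_nat n * \<phi> z" using n by simp
  also have "\<dots> \<noteq> 0" using n z by simp
  finally obtain j where "j < n" "(\<Sum>i<n. (\<zeta> ^ j) ^ i * \<phi> (g [^] i \<otimes> z)) \<noteq> 0"
    by (meson lessThan_iff sum.neutral)
  moreover have "(\<zeta> ^ j) ^ n = 1"
    using zn by (simp add: power_mult[symmetric] mult.commute[of j] power_mult)
  ultimately show thesis
    using that[of "\<zeta> ^ j"] z(1) unfolding n_def by blast
qed

lemma exists_common_translation_eigenvector:
  assumes "finite A" "A \<subseteq> carrier G" "\<exists>z\<in>carrier G. \<phi> z \<noteq> (0::complex)"
    and "\<And>\<chi>. \<chi> \<in> characters G \<Longrightarrow> (\<Sum>z\<in>carrier G. \<phi> z * \<chi> z) = 0"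
  shows "\<exists>\<psi> c. (\<exists>z\<in>carrier G. \<psi> z \<noteq> (0::complex)) \<and>
    (\<forall>\<chi>\<in>characters G. (\<Sum>z\<in>carrier G. \<psi> z * \<chi> z) = 0) \<and>
    (\<forall>g\<in>A. \<forall>z\<in>carrier G. \<psi> (g \<otimes> z) = c g * \<psi> z)"
  using assms(1,2)
proof (induction A)
  case empty
  then show ?case using assms(3,4) by blast
next
  case (insert g A)
  then have "A \<subseteq> carrier G" by simp
  from insert.IH[OF this] obtain \<psi> c where *: "\<exists>z\<in>carrier G. \<psi> z \<noteq> (0::complex)"
    "\<forall>\<chi>\<in>characters G. (\<Sum>z\<in>carrier G. \<psi> z * \<chi> z) = 0"
    "\<forall>g\<in>A. \<forall>z\<in>carrier G. \<psi> (g \<otimes> z) = c g * \<psi> z"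
    by (elim exE conjE)
  note \<psi> = *(1) bspec[OF *(2)] bspec[OF bspec[OF *(3)]]
  have g: "g \<in> carrier G" and A: "A \<subseteq> carrier G" using insert.prems by auto
  define n where "n = Coset.order G"
  obtain d where d: "\<exists>z\<in>carrier G. (\<Sum>i<n. d ^ i * \<psi> (g [^] i \<otimes> z)) \<noteq> 0" "d ^ n = 1"
    using exists_translation_eigenvector[OF g \<psi>(1)] unfolding n_def by blast
  have n: "n > 0" unfolding n_def by (rule order_pos)
  have d0: "d \<noteq> 0" using d(2) n by (metis power_0_left zero_neq_one less_numeral_extra(3))
  define \<psi>' where "\<psi>' z = (\<Sum>i<n. d ^ i * \<psi> (g [^] i \<otimes> z))" for z
  have gn: "g [^] n = \<one>" unfolding n_def using g by (rule pow_order_eq_1)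
  have 1: "\<psi>' (g \<otimes> z) = inverse d * \<psi>' z" if z: "z \<in> carrier G" for z
  proof -
    have "d * \<psi>' (g \<otimes> z) = (\<Sum>i<n. d ^ Suc i * \<psi> (g [^] Suc i \<otimes> z))"
      unfolding \<psi>'_def sum_distrib_left using g z by (simp add: m_assoc mult.assoc)
    also have "\<dots> = (\<Sum>i<Suc n. d ^ i * \<psi> (g [^] i \<otimes> z)) - d ^ 0 * \<psi> (g [^] (0::nat) \<otimes> z)"
      by (subst sum.lessThan_Suc_shift) simp
    also have "\<dots> = \<psi>' z" unfolding \<psi>'_def using d(2) gn by simp
    finally show ?thesis using d0 by (simp add: field_simps)
  qed
  have 2: "\<psi>' (h \<otimes> z) = c h * \<psi>' z" if "h \<in> A" "z \<in> carrier G" for h z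
  proof -
    have "g [^] i \<otimes> (h \<otimes> z) = h \<otimes> (g [^] i \<otimes> z)" for i :: nat
      using that A g by (intro m_lcomm) auto
    then show ?thesis
      unfolding \<psi>'_def sum_distrib_left using \<psi>(3) that g
      by (intro sum.cong refl) simp
  qed
  have 3: "(\<Sum>z\<in>carrier G. \<psi>' z * \<chi> z) = 0" if \<chi>: "\<chi> \<in> characters G" for \<chi>
  proof -
    have "(\<Sum>z\<in>carrier G. \<psi> (g [^] i \<otimes> z) * \<chi> z) = 0" for i :: nat
    proof -
      have gi: "g [^] i \<in> carrier G" using g by simp
      have "\<chi> (g [^] i) * (\<Sum>z\<in>carrier G. \<psi> (g [^] i \<otimes> z) * \<chi> z) =
          (\<Sum>z\<in>carrier G. \<psi> (g [^] i \<otimes> z) * \<chi> (g [^] i \<otimes> z))"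
        unfolding sum_distrib_left using \<chi> gi by (intro sum.cong refl) (simp add: char_mult)
      also have "\<dots> = (\<Sum>z\<in>carrier G. \<psi> z * \<chi> z)"
        using gi by (rule sum_translate)
      finally show ?thesis using \<psi>(2)[OF \<chi>] char_neq_0[OF \<chi> gi] by simp
    qed
    moreover have "(\<Sum>z\<in>carrier G. \<psi>' z * \<chi> z) =
        (\<Sum>i<n. d ^ i * (\<Sum>z\<in>carrier G. \<psi> (g [^] i \<otimes> z) * \<chi> z))"
      unfolding \<psi>'_def sum_distrib_left sum_distrib_right
      by (subst sum.swap) (simp add: mult.assoc)
    ultimately show ?thesis by simp
  qed
  show ?case
  proof (rule exI[of _ \<psi>'], rule exI[of _ "c(g := inverse d)"], intro conjI ballI)
    show "\<exists>z\<in>carrier G. \<psi>' z \<noteq> 0" using d(1) unfolding \<psi>'_def .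
  qed (use 1 2 3 insert.hyps in auto)
qed

theorem characters_separate_functions:
  assumes "\<And>\<chi>. \<chi> \<in> characters G \<Longrightarrow> (\<Sum>z\<in>carrier G. \<phi> z * \<chi> z) = 0" "z \<in> carrier G"
  shows "\<phi> z = 0"
proof (rule ccontr)
  assume "\<phi> z \<noteq> 0"
  then obtain \<psi> c where \<psi>: "\<exists>z\<in>carrier G. \<psi> z \<noteq> (0::complex)"
    "\<And>\<chi>. \<chi> \<in> characters G \<Longrightarrow> (\<Sum>z\<in>carrier G. \<psi> z * \<chi> z) = 0"
    "\<And>h z. h \<in> carrier G \<Longrightarrow> z \<in> carrier G \<Longrightarrow> \<psi> (h \<otimes> z) = c h * \<psi> z"
    using exists_common_translation_eigenvector[OF finite_carrier subset_refl, of \<phi>] assms by blast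
  have \<psi>_eq: "\<psi> h = c h * \<psi> \<one>" if "h \<in> carrier G" for h
    using \<psi>(3)[of h \<one>] that by simp
  then have nz: "\<psi> \<one> \<noteq> 0" using \<psi>(1) by force
  have c: "restrict c (carrier G) \<in> characters G"
  proof (rule restrict_in_characters)
    show "c \<one> = 1" using \<psi>_eq[of \<one>] nz by simp
    fix x y assume "x \<in> carrier G" "y \<in> carrier G"
    then show "c (x \<otimes> y) = c x * c y" using \<psi>_eq[of "x \<otimes> y"] \<psi>_eq[of y] \<psi>(3)[of x y] nz by simp
  qed
  have "(\<Sum>z\<in>carrier G. \<psi> z * (\<lambda>x\<in>carrier G. restrict c (carrier G) (inv x)) z) =
      (\<Sum>z\<in>carrier G. \<psi> \<one>)"
  proof (rule sum.cong[OF refl])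
    fix z assume z: "z \<in> carrier G"
    then have "c z * c (inv z) = 1" using char_inv[OF c z] by (simp add: mult.commute)
    then show "\<psi> z * (\<lambda>x\<in>carrier G. restrict c (carrier G) (inv x)) z = \<psi> \<one>"
      using z by (simp add: \<psi>_eq[OF z])
  qed
  then show False
    using \<psi>(2)[OF char_comp_inv[OF c]] nz order_pos by (simp add: Coset.order_def)
qed

lemma exists_char_neq_1:
  assumes "x \<in> carrier G" "x \<noteq> \<one>"
  obtains \<chi> where "\<chi> \<in> characters G" "\<chi> x \<noteq> 1"
proof -
  have "\<exists>\<chi>\<in>characters G. \<chi> x \<noteq> 1"
  proof (rule ccontr)
    assume *: "\<not> ?thesis"
    define \<phi> :: "'a \<Rightarrow> complex" where "\<phi> z = of_bool (z = x) - of_bool (z = \<one>)" for z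
    have "\<phi> x = 0"
    proof (rule characters_separate_functions[OF _ assms(1)])
      fix \<chi> assume \<chi>: "\<chi> \<in> characters G"
      have "(\<Sum>z\<in>carrier G. \<phi> z * \<chi> z) = \<chi> x - \<chi> \<one>"
        using finite_carrier assms(1) unfolding \<phi>_def
        by (simp add: left_diff_distrib sum_subtractf of_bool_def if_distrib[of "\<lambda>a. a * _"] cong: if_cong)
      then show "(\<Sum>z\<in>carrier G. \<phi> z * \<chi> z) = 0" using * \<chi> by (simp add: char_one)
    qed
    then show False using assms(2) by (simp add: \<phi>_def)
  qed
  then show thesis using that by blast
qed

lemma sum_characters:
  assumes x: "x \<in> carrier G"
  shows "(\<Sum>\<chi>\<in>characters G. \<chi> x) = (if x = \<one> then of_nat (card (characters G)) else 0)"
proof (cases "x = \<one>")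
  case True
  then show ?thesis by (simp add: char_one)
next
  case False
  then obtain \<eta> where \<eta>: "\<eta> \<in> characters G" "\<eta> x \<noteq> 1" using exists_char_neq_1 x by blast
  define \<eta>' where "\<eta>' = (\<lambda>x\<in>carrier G. \<eta> (inv x))"
  have \<eta>': "\<eta>' \<in> characters G" unfolding \<eta>'_def using \<eta>(1) by (rule char_comp_inv)
  have inv: "\<eta>' y * (\<eta> y * a) = a" "\<eta> y * (\<eta>' y * a) = a" if "y \<in> carrier G" for y a
    using char_inv[OF \<eta>(1) that] that by (simp_all add: \<eta>'_def mult.assoc[symmetric] mult.commute)
  have "(\<Sum>\<chi>\<in>characters G. \<eta> x * \<chi> x) = (\<Sum>\<chi>\<in>characters G. \<chi> x)"
    by (rule sum.reindex_bij_witness[of _ "\<lambda>\<chi>. \<lambda>y\<in>carrier G. \<eta>' y * \<chi> y" "\<lambda>\<chi>. \<lambda>y\<in>carrier G. \<eta> y * \<chi> y"])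
       (use x \<eta> \<eta>' in \<open>auto intro: char_times_char simp: inv characters_def extensional_def restrict_def fun_eq_iff\<close>)
  then have "\<eta> x * (\<Sum>\<chi>\<in>characters G. \<chi> x) = (\<Sum>\<chi>\<in>characters G. \<chi> x)"
    by (simp only: sum_distrib_left)
  then show ?thesis using \<eta>(2) False by simp
qed

lemma sum_char:
  assumes "\<chi> \<in> characters G"
  shows "(\<Sum>x\<in>carrier G. \<chi> x) = (if \<chi> = (\<lambda>x\<in>carrier G. 1) then of_nat (Coset.order G) else 0)"
proof (cases "\<forall>x\<in>carrier G. \<chi> x = 1")
  case True
  then have "\<chi> = (\<lambda>x\<in>carrier G. 1)"
    using assms by (auto simp: characters_def extensional_def restrict_def fun_eq_iff)
  then show ?thesis by (simp add: Coset.order_def)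
next
  case False
  then obtain g where g: "g \<in> carrier G" "\<chi> g \<noteq> 1" by blast
  have "\<chi> g * (\<Sum>x\<in>carrier G. \<chi> x) = (\<Sum>x\<in>carrier G. \<chi> (g \<otimes> x))"
    unfolding sum_distrib_left using assms g(1) by (intro sum.cong) (auto simp: char_mult)
  also have "\<dots> = (\<Sum>x\<in>carrier G. \<chi> x)" using g(1) by (rule sum_translate)
  finally have "(\<chi> g - 1) * (\<Sum>x\<in>carrier G. \<chi> x) = 0" by (simp add: algebra_simps)
  moreover have "\<chi> \<noteq> (\<lambda>x\<in>carrier G. 1)" using False by auto
  ultimately show ?thesis using g(2) by simp
qed

lemma card_characters: "card (characters G) = Coset.order G"
proof -
  have triv: "(\<lambda>x\<in>carrier G. 1) \<in> characters G" by (rule restrict_in_characters) auto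
  have "of_nat (card (characters G)) = (\<Sum>x\<in>carrier G. \<Sum>\<chi>\<in>characters G. \<chi> x)"
    using finite_carrier by (simp add: sum_characters)
  also have "\<dots> = (\<Sum>\<chi>\<in>characters G. \<Sum>x\<in>carrier G. \<chi> x)" by (rule sum.swap)
  also have "\<dots> = of_nat (Coset.order G)"
    using finite_characters triv by (simp add: sum_char)
  finally show ?thesis by (simp only: of_nat_eq_iff)
qed

end

section \<open>The weights and their Galois conjugates\<close>

definition weight6 :: complex where
  "weight6 = (1 + \<i> * complex_of_real (sqrt 3)) / 2"

lemma cnj_weight6_eq: "cnj weight6 = (1 - \<i> * complex_of_real (sqrt 3)) / 2"
  by (simp add: weight6_def)

lemma cnj_weight6: "cnj weight6 = 1 - weight6"
  by (simp add: weight6_def field_simps)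

lemma weight6_sq: "weight6 * weight6 = weight6 - 1"
  by (simp add: weight6_def complex_eq_iff)

lemma weight6_nonreal: "weight6 \<noteq> cnj weight6" "weight6 \<noteq> 0" "weight6 \<noteq> 1"
  "cnj weight6 \<noteq> 0" "cnj weight6 \<noteq> 1"
  by (auto simp: weight6_def complex_eq_iff)

lemma weight6_cube: "(- weight6) ^ 3 = 1"
proof -
  have "(- weight6) ^ 3 = - (weight6 * (weight6 * weight6))" by (simp add: power3_eq_cube)
  also have "\<dots> = 1" by (simp add: weight6_sq algebra_simps)
  finally show ?thesis .
qed

text \<open>The action on \<open>\<rat>(\<surd>-3)\<close> of the automorphism \<open>\<zeta> \<mapsto> \<zeta>\<^sup>k\<close> of a cyclotomic field containing it.\<close>

definition galois3 :: "nat \<Rightarrow> complex \<Rightarrow> complex" where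
  "galois3 k z = (if [k = 1] (mod 3) then z else cnj z)"

abbreviation weights :: "complex set" where
  "weights \<equiv> {0, 1, weight6, cnj weight6}"

lemma not_3_dvd_cases:
  assumes "\<not> 3 dvd (k::nat)" obtains "[k = 1] (mod 3)" | "[k = 2] (mod 3)"
proof -
  have "k mod 3 = 1 \<or> k mod 3 = 2" using assms by presburger
  then show thesis using that by (auto simp: cong_def)
qed

lemma galois3_mult:
  assumes "\<not> 3 dvd j" "\<not> 3 dvd k"
  shows "galois3 (j * k) z = galois3 j (galois3 k z)"
proof -
  have "[j * k = (j mod 3) * (k mod 3)] (mod 3)" by (simp add: cong_def mod_mult_eq)
  moreover have "j mod 3 = 1 \<or> j mod 3 = 2" "k mod 3 = 1 \<or> k mod 3 = 2"
    using assms by presburger+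
  ultimately show ?thesis by (auto simp: galois3_def cong_def)
qed

lemma galois3_1: "galois3 1 z = z" "galois3 (Suc 0) z = z"
  by (simp_all add: galois3_def)

lemma galois3_weights: "v \<in> weights \<Longrightarrow> galois3 k v \<in> weights"
  by (auto simp: galois3_def)

lemma galois3_weights_power:
  assumes "v \<in> weights"
  obtains e u where "e \<in> \<int>" "u ^ 3 = 1" "\<And>k. \<not> 3 dvd k \<Longrightarrow> galois3 k v = e * u ^ k"
proof -
  have *: "galois3 k (- u) = (-1) * u ^ k" if "\<not> 3 dvd k" "u ^ 3 = 1" "cnj u = u ^ 2" for k u
    using that(1)
  proof (cases rule: not_3_dvd_cases)
    case 1
    then have "k = 3 * (k div 3) + 1" unfolding cong_def by presburger
    then have "u ^ k = u ^ (3 * (k div 3) + 1)" by (rule arg_cong)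
    also have "\<dots> = u" using that(2) by (simp add: power_add power_mult)
    finally show ?thesis using 1 by (simp add: galois3_def)
  next
    case 2
    then have "k = 3 * (k div 3) + 2" unfolding cong_def by presburger
    then have "u ^ k = u ^ (3 * (k div 3) + 2)" by (rule arg_cong)
    also have "\<dots> = cnj u" using that(2,3) by (simp add: power_add power_mult power2_eq_square)
    finally show ?thesis using 2 by (simp add: galois3_def cong_def)
  qed
  have c: "cnj (- weight6) = (- weight6) ^ 2"
    by (simp add: power2_eq_square weight6_sq cnj_weight6)
  have cube': "(- cnj weight6) ^ 3 = 1"
    using arg_cong[OF weight6_cube, of cnj]
    by (simp only: complex_cnj_power complex_cnj_minus complex_cnj_one)
  have c': "cnj (- cnj weight6) = (- cnj weight6) ^ 2"
    using arg_cong[OF c, of cnj] by (simp only: complex_cnj_power complex_cnj_minus)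
  consider "v = 0" | "v = 1" | "v = weight6" | "v = cnj weight6" using assms by blast
  then show thesis
  proof cases
    case 1
    then show ?thesis by (intro that[of 0 1]) (simp_all add: galois3_def)
  next
    case 2
    then show ?thesis by (intro that[of 1 1]) (simp_all add: galois3_def)
  next
    case 3
    have "galois3 k v = (-1) * (- weight6) ^ k" if "\<not> 3 dvd k" for k
      using *[OF that weight6_cube c] unfolding 3 minus_minus .
    then show ?thesis by (intro that[of "-1" "- weight6"] weight6_cube) simp_all
  next
    case 4
    have "galois3 k v = (-1) * (- cnj weight6) ^ k" if "\<not> 3 dvd k" for k
      using *[OF that cube' c'] unfolding 4 minus_minus .
    then show ?thesis by (intro that[of "-1" "- cnj weight6"] cube') simp_all
  qed
qed

lemma weights_in_cyclotomic_integers: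
  assumes "v \<in> weights" "n > 0" "3 dvd n"
  shows "v \<in> cyclotomic_integers n"
proof -
  obtain e u where eu: "e \<in> \<int>" "u ^ 3 = 1" "\<And>k. \<not> 3 dvd k \<Longrightarrow> galois3 k v = e * u ^ k"
    using galois3_weights_power[OF assms(1)] by blast
  have "u ^ n = 1" using eu(2) assms(3) by (auto elim!: dvdE simp: power_mult)
  then have "u \<in> cyclotomic_integers n"
    using root_of_unity_in_cyclotomic_integers assms(2) by blast
  moreover have "e \<in> cyclotomic_integers n"
    using eu(1) by (auto elim: Ints_cases intro: cyclotomic_integers_of_int)
  moreover have "v = e * u" using eu(3)[of 1] by (simp add: galois3_1)
  ultimately show ?thesis by (simp add: cyclotomic_integers_mult)
qed

lemma weights_power_prime:
  assumes "v \<in> weights" "n > 0" "3 dvd n" "prime p" "p \<noteq> 3"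
  shows "v ^ p - galois3 p v \<in> cyclotomic_multiples n p"
proof -
  obtain e u where eu: "e \<in> \<int>" "u ^ 3 = 1" "\<And>k. \<not> 3 dvd k \<Longrightarrow> galois3 k v = e * u ^ k"
    using galois3_weights_power[OF assms(1)] by blast
  have "u ^ n = 1" using eu(2) assms(3) by (auto elim!: dvdE simp: power_mult)
  then have "u \<in> cyclotomic_integers n"
    using root_of_unity_in_cyclotomic_integers assms(2) by blast
  moreover have "v = e * u" using eu(3)[of 1] by (simp add: galois3_1)
  moreover have "\<not> 3 dvd p" using assms(4,5) primes_dvd_imp_eq[of 3 p] by auto
  then have "galois3 p v = e * u ^ p" by (rule eu(3))
  ultimately show ?thesis
    using cyclotomic_multiples_mult[OF fermat_little_cyclotomic[OF assms(4) eu(1)] cyclotomic_integers_power]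
    by (simp add: power_mult_distrib left_diff_distrib)
qed

lemma weights_diff_norm:
  assumes "v \<in> weights" "v' \<in> weights" "v \<noteq> v'"
  shows "(v - v') * (cnj v - cnj v') \<in> {1, 3}"
  using assms by (elim insertE emptyE; hypsubst) (simp_all add: weight6_def complex_eq_iff)

section \<open>Eigenvalues of mixed Cayley graphs\<close>

definition cayley_weight :: "('a, 'b) monoid_scheme \<Rightarrow> 'a set \<Rightarrow> 'a \<Rightarrow> complex" where
  "cayley_weight G S s = (if s \<in> S \<and> inv\<^bsub>G\<^esub> s \<in> S then 1 else if s \<in> S then weight6
     else if inv\<^bsub>G\<^esub> s \<in> S then cnj weight6 else 0)"

lemma cayley_weight_in_weights: "cayley_weight G S s \<in> weights"
  by (auto simp: cayley_weight_def)

lemma cayley_weight_eq_1_iff: "cayley_weight G S s = 1 \<longleftrightarrow> s \<in> S - skew_part G S"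
  using weight6_nonreal by (auto simp: cayley_weight_def skew_part_def)

lemma cayley_weight_eq_weight6_iff: "cayley_weight G S s = weight6 \<longleftrightarrow> s \<in> skew_part G S"
  using weight6_nonreal by (auto simp: cayley_weight_def skew_part_def)

locale finite_cayley = finite_comm_group G for G (structure) +
  fixes S
  assumes S_closed: "S \<subseteq> carrier G"
begin

abbreviation wt :: "'a \<Rightarrow> complex" where "wt \<equiv> cayley_weight G S"

abbreviation n3 :: nat where "n3 \<equiv> 3 * Coset.order G"

definition fourier :: "('a \<Rightarrow> complex) \<Rightarrow> complex" where
  "fourier \<chi> = (\<Sum>s\<in>carrier G. wt s * \<chi> s)"

lemma n3_pos: "n3 > 0"
  using order_pos by simp

lemma wt_inv: "s \<in> carrier G \<Longrightarrow> wt (inv s) = cnj (wt s)"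
  by (simp add: cayley_weight_def)

lemma hermitian_adjacency2_cayley:
  assumes "u \<in> carrier G" "v \<in> carrier G"
  shows "hermitian_adjacency2 (cayley_mixed_graph G S) u v = wt (v \<otimes> inv u)"
proof -
  have "inv (v \<otimes> inv u) = u \<otimes> inv v"
    using assms by (simp add: inv_mult_group)
  then show ?thesis
    using assms unfolding hermitian_adjacency2_def cayley_mixed_graph_def cayley_weight_def
    by (simp add: weight6_def[symmetric] cnj_weight6_eq[symmetric])
qed

lemma wt_convolution:
  assumes "\<chi> \<in> characters G" "u \<in> carrier G"
  shows "(\<Sum>v\<in>carrier G. wt (v \<otimes> inv u) * \<chi> v) = fourier \<chi> * \<chi> u"
proof -
  have "(\<Sum>v\<in>carrier G. wt (v \<otimes> inv u) * \<chi> v) =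
      (\<Sum>v\<in>carrier G. wt ((u \<otimes> v) \<otimes> inv u) * \<chi> (u \<otimes> v))"
    using assms(2) by (rule sum_translate[symmetric])
  also have "\<dots> = (\<Sum>v\<in>carrier G. (wt v * \<chi> v) * \<chi> u)"
  proof (rule sum.cong[OF refl])
    fix v assume v: "v \<in> carrier G"
    have "(u \<otimes> v) \<otimes> inv u = v" using assms(2) v by (simp add: m_comm[of u v] m_assoc)
    then show "wt ((u \<otimes> v) \<otimes> inv u) * \<chi> (u \<otimes> v) = (wt v * \<chi> v) * \<chi> u"
      using assms v by (simp add: char_mult)
  qed
  finally show ?thesis by (simp add: fourier_def sum_distrib_right)
qed

lemma HS_integral_cayley_iff:
  "HS_integral (cayley_mixed_graph G S) \<longleftrightarrow> (\<forall>\<chi>\<in>characters G. fourier \<chi> \<in> \<int>)"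
proof -
  have eig: "eigenvalue_on (pverts (cayley_mixed_graph G S)) (hermitian_adjacency2 (cayley_mixed_graph G S)) c
    \<longleftrightarrow> (\<exists>x. (\<exists>u\<in>carrier G. x u \<noteq> 0) \<and>
          (\<forall>u\<in>carrier G. (\<Sum>v\<in>carrier G. wt (v \<otimes> inv u) * x v) = c * x u))" for c
    unfolding eigenvalue_on_def by (simp add: cayley_mixed_graph_def[of G S, THEN arg_cong, of pverts] hermitian_adjacency2_cayley)
  show ?thesis
    unfolding HS_integral_def eig
  proof (intro iffI ballI allI impI)
    fix \<chi> assume *: "\<forall>c. (\<exists>x. (\<exists>u\<in>carrier G. x u \<noteq> 0) \<and>
          (\<forall>u\<in>carrier G. (\<Sum>v\<in>carrier G. wt (v \<otimes> inv u) * x v) = c * x u)) \<longrightarrow> c \<in> \<int>"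
      and \<chi>: "\<chi> \<in> characters G"
    have "\<exists>u\<in>carrier G. \<chi> u \<noteq> 0" using char_one[OF \<chi>] one_closed by force
    then show "fourier \<chi> \<in> \<int>" using * wt_convolution[OF \<chi>] by blast
  next
    fix c assume *: "\<forall>\<chi>\<in>characters G. fourier \<chi> \<in> \<int>"
      and "\<exists>x. (\<exists>u\<in>carrier G. x u \<noteq> 0) \<and>
          (\<forall>u\<in>carrier G. (\<Sum>v\<in>carrier G. wt (v \<otimes> inv u) * x v) = c * x u)"
    then obtain x where x: "\<exists>u\<in>carrier G. x u \<noteq> 0"
      "\<And>u. u \<in> carrier G \<Longrightarrow> (\<Sum>v\<in>carrier G. wt (v \<otimes> inv u) * x v) = c * x u"
      by blast
    obtain \<chi> where \<chi>: "\<chi> \<in> characters G" "(\<Sum>u\<in>carrier G. x u * \<chi> u) \<noteq> 0"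
      using characters_separate_functions x(1) by blast
    define \<chi>' where "\<chi>' = (\<lambda>x\<in>carrier G. \<chi> (inv x))"
    have \<chi>': "\<chi>' \<in> characters G" unfolding \<chi>'_def using \<chi>(1) by (rule char_comp_inv)
    have conv: "(\<Sum>u\<in>carrier G. wt (v \<otimes> inv u) * \<chi> u) = fourier \<chi>' * \<chi> v" if v: "v \<in> carrier G" for v
    proof -
      have "(\<Sum>u\<in>carrier G. wt (v \<otimes> inv u) * \<chi> u) = (\<Sum>u\<in>carrier G. wt (v \<otimes> u) * \<chi> (inv u))"
        by (subst sum_inv[symmetric]) simp
      also have "\<dots> = (\<Sum>u\<in>carrier G. wt (v \<otimes> u) * \<chi> (inv (v \<otimes> u)) * \<chi> v)"
      proof (rule sum.cong[OF refl])
        fix u assume u: "u \<in> carrier G"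
        have "inv (v \<otimes> u) \<otimes> v = inv u"
          using u v by (simp add: inv_mult m_assoc m_comm[of "inv u" v] m_assoc[symmetric])
        then have "\<chi> (inv (v \<otimes> u)) * \<chi> v = \<chi> (inv u)"
          using u v \<chi>(1) by (metis char_mult inv_closed m_closed)
        then show "wt (v \<otimes> u) * \<chi> (inv u) = wt (v \<otimes> u) * \<chi> (inv (v \<otimes> u)) * \<chi> v"
          by (simp add: mult.assoc)
      qed
      also have "\<dots> = (\<Sum>u\<in>carrier G. wt u * \<chi> (inv u) * \<chi> v)"
        using v by (rule sum_translate)
      also have "\<dots> = fourier \<chi>' * \<chi> v"
        unfolding fourier_def sum_distrib_right by (intro sum.cong refl) (simp add: \<chi>'_def)
      finally show ?thesis .
    qed
    have "c * (\<Sum>u\<in>carrier G. x u * \<chi> u) =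
        (\<Sum>u\<in>carrier G. \<Sum>v\<in>carrier G. wt (v \<otimes> inv u) * x v * \<chi> u)"
      unfolding sum_distrib_left using x(2) by (intro sum.cong refl) (simp flip: sum_distrib_right)
    also have "\<dots> = (\<Sum>v\<in>carrier G. x v * (\<Sum>u\<in>carrier G. wt (v \<otimes> inv u) * \<chi> u))"
      unfolding sum_distrib_left by (subst sum.swap) (simp add: mult_ac)
    also have "\<dots> = (\<Sum>v\<in>carrier G. fourier \<chi>' * (x v * \<chi> v))"
      using conv by (intro sum.cong refl) (simp add: mult_ac)
    also have "\<dots> = fourier \<chi>' * (\<Sum>u\<in>carrier G. x u * \<chi> u)" by (simp add: sum_distrib_left)
    finally have "c = fourier \<chi>'" using \<chi>(2) by simp
    then show "c \<in> \<int>" using * \<chi>' by simp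
  qed
qed

lemma char_in_cyclotomic_integers:
  assumes "\<chi> \<in> characters G" "x \<in> carrier G"
  shows "\<chi> x \<in> cyclotomic_integers n3"
proof (rule root_of_unity_in_cyclotomic_integers[OF n3_pos])
  show "\<chi> x ^ n3 = 1"
    using char_pow_order[OF assms] by (simp add: power_mult mult.commute[of 3])
qed

lemma wt_in_cyclotomic_integers: "wt x \<in> cyclotomic_integers n3"
  using weights_in_cyclotomic_integers[OF cayley_weight_in_weights n3_pos] by simp

definition galois_equivariant :: bool where
  "galois_equivariant \<longleftrightarrow>
     (\<forall>k. coprime k n3 \<longrightarrow> (\<forall>s\<in>carrier G. wt (s [^] (k::nat)) = galois3 k (wt s)))"

lemma coprime_n3D:
  assumes "coprime k n3"
  shows "\<not> 3 dvd k" "coprime k (Coset.order G)"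
proof -
  have "coprime k 3" using assms by simp
  then show "\<not> 3 dvd k" using coprime_common_divisor_nat[of k 3 3] by auto
  show "coprime k (Coset.order G)" using assms by simp
qed

lemma fourier_Ints_if_equivariant:
  assumes gal: galois_equivariant and \<chi>: "\<chi> \<in> characters G"
  shows "fourier \<chi> \<in> \<int>"
proof (rule cyclotomic_integers_Rats_imp_Ints[OF n3_pos])
  show "fourier \<chi> \<in> cyclotomic_integers n3"
    unfolding fourier_def using \<chi>
    by (intro cyclotomic_integers_sum cyclotomic_integers_mult wt_in_cyclotomic_integers
        char_in_cyclotomic_integers)
  have inner: "(\<Sum>k\<in>totatives n3. galois3 k (wt s) * \<chi> s ^ k) \<in> \<int>" if s: "s \<in> carrier G" for s
  proof -
    obtain e u where eu: "e \<in> \<int>" "u ^ 3 = 1" "\<And>k. \<not> 3 dvd k \<Longrightarrow> galois3 k (wt s) = e * u ^ k"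
      using galois3_weights_power[OF cayley_weight_in_weights[of G S s]] by blast
    have "(\<Sum>k\<in>totatives n3. galois3 k (wt s) * \<chi> s ^ k) = e * (\<Sum>k\<in>totatives n3. (u * \<chi> s) ^ k)"
      unfolding sum_distrib_left
    proof (rule sum.cong[OF refl])
      fix k assume "k \<in> totatives n3"
      then have "\<not> 3 dvd k" using coprime_n3D(1) by (simp add: in_totatives_iff)
      then show "galois3 k (wt s) * \<chi> s ^ k = e * (u * \<chi> s) ^ k"
        using eu(3) by (simp add: power_mult_distrib)
    qed
    moreover have "(u * \<chi> s) ^ n3 = (u ^ 3) ^ Coset.order G * (\<chi> s ^ Coset.order G) ^ 3"
      by (simp add: power_mult_distrib power_mult[symmetric] mult.commute)
    then have "(u * \<chi> s) ^ n3 = 1" using eu(2) char_pow_order[OF \<chi> s] by simp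
    then have "(\<Sum>k\<in>totatives n3. (u * \<chi> s) ^ k) \<in> \<int>" using ramanujan_sum_Ints n3_pos by blast
    ultimately show ?thesis using eu(1) by simp
  qed
  have "of_nat (totient n3) * fourier \<chi> = (\<Sum>k\<in>totatives n3. fourier \<chi>)"
    by (simp add: totient_def)
  also have "\<dots> = (\<Sum>k\<in>totatives n3. \<Sum>s\<in>carrier G. galois3 k (wt s) * \<chi> s ^ k)"
  proof (rule sum.cong[OF refl])
    fix k assume "k \<in> totatives n3"
    then have k: "coprime k n3" by (simp add: in_totatives_iff)
    have "fourier \<chi> = (\<Sum>s\<in>carrier G. wt (s [^] k) * \<chi> (s [^] k))"
      unfolding fourier_def by (rule sum_pow[OF coprime_n3D(2)[OF k], symmetric])
    also have "\<dots> = (\<Sum>s\<in>carrier G. galois3 k (wt s) * \<chi> s ^ k)"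
      using gal k \<chi> unfolding galois_equivariant_def by (intro sum.cong refl) (simp add: char_pow)
    finally show "fourier \<chi> = (\<Sum>s\<in>carrier G. galois3 k (wt s) * \<chi> s ^ k)" .
  qed
  also have "\<dots> = (\<Sum>s\<in>carrier G. \<Sum>k\<in>totatives n3. galois3 k (wt s) * \<chi> s ^ k)" by (rule sum.swap)
  also have "\<dots> \<in> \<int>" using inner by (rule Ints_sum)
  finally have "of_nat (totient n3) * fourier \<chi> \<in> \<rat>" using Ints_subset_Rats by blast
  then have "of_nat (totient n3) * fourier \<chi> / of_nat (totient n3) \<in> \<rat>" by (intro Rats_divide) auto
  then show "fourier \<chi> \<in> \<rat>" using n3_pos by simp
qed

lemma fourier_Frobenius:
  assumes p: "prime p" "\<not> p dvd n3" and \<chi>: "\<chi> \<in> characters G" and int: "fourier \<chi> \<in> \<int>"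
  shows "(\<Sum>s\<in>carrier G. (wt (s [^] p) - galois3 p (wt s)) * \<chi> (s [^] p)) \<in> cyclotomic_multiples n3 p"
proof -
  have p3: "p \<noteq> 3" using p(2) by auto
  have "coprime p n3" using p prime_imp_coprime by blast
  then have eq: "fourier \<chi> = (\<Sum>s\<in>carrier G. wt (s [^] p) * \<chi> (s [^] p))"
    unfolding fourier_def by (rule sum_pow[OF coprime_n3D(2), symmetric])
  have a: "fourier \<chi> ^ p - fourier \<chi> \<in> cyclotomic_multiples n3 p"
    using fermat_little_cyclotomic[OF p(1) int] .
  have b: "fourier \<chi> ^ p - (\<Sum>s\<in>carrier G. (wt s * \<chi> s) ^ p) \<in> cyclotomic_multiples n3 p"
    unfolding fourier_def using finite_carrier \<chi>
    by (intro freshmans_dream_cyclotomic_sum p(1) cyclotomic_integers_mult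
        wt_in_cyclotomic_integers char_in_cyclotomic_integers)
  have c: "(\<Sum>s\<in>carrier G. (wt s ^ p - galois3 p (wt s)) * \<chi> s ^ p) \<in> cyclotomic_multiples n3 p"
    using \<chi> p(1) p3 n3_pos
    by (intro cyclotomic_multiples_sum cyclotomic_multiples_mult weights_power_prime
        cayley_weight_in_weights cyclotomic_integers_power char_in_cyclotomic_integers) auto
  have "(\<Sum>s\<in>carrier G. (wt (s [^] p) - galois3 p (wt s)) * \<chi> (s [^] p)) =
      fourier \<chi> - (\<Sum>s\<in>carrier G. galois3 p (wt s) * \<chi> s ^ p)"
    unfolding eq sum_subtractf[symmetric] using \<chi>
    by (intro sum.cong refl) (simp add: char_pow left_diff_distrib)
  also have "\<dots> = (fourier \<chi> ^ p - (\<Sum>s\<in>carrier G. (wt s * \<chi> s) ^ p)) - (fourier \<chi> ^ p - fourier \<chi>)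
      + (\<Sum>s\<in>carrier G. (wt s ^ p - galois3 p (wt s)) * \<chi> s ^ p)"
    by (simp add: left_diff_distrib sum_subtractf power_mult_distrib)
  also have "\<dots> \<in> cyclotomic_multiples n3 p"
    by (intro cyclotomic_multiples_add cyclotomic_multiples_diff a b c)
  finally show ?thesis .
qed

lemma equivariant_prime:
  assumes int: "\<And>\<chi>. \<chi> \<in> characters G \<Longrightarrow> fourier \<chi> \<in> \<int>"
    and p: "prime p" "\<not> p dvd n3" and x: "x \<in> carrier G"
  shows "wt (x [^] p) = galois3 p (wt x)"
proof (rule ccontr)
  define h where "h s = wt (s [^] p) - galois3 p (wt s)" for s
  assume neq: "wt (x [^] p) \<noteq> galois3 p (wt x)"
  have cop: "coprime p n3" using p prime_imp_coprime by blast
  have delta: "(\<Sum>\<chi>\<in>characters G. \<chi> (s [^] p) * \<chi> (inv (x [^] p))) = (if s = x then of_nat (Coset.order G) else 0)"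
    if s: "s \<in> carrier G" for s
  proof -
    have "s [^] p = x [^] p \<longleftrightarrow> s = x"
    proof -
      obtain l :: nat where "coprime l (Coset.order G)" "[p * l = 1] (mod Coset.order G)"
        and l: "\<And>x. x \<in> carrier G \<Longrightarrow> (x [^] p) [^] l = x"
        by (rule ex_pow_inverse[OF coprime_n3D(2)[OF cop] dvd_refl order_pos], rule that)
      show ?thesis using l[OF s] l[OF x] by metis
    qed
    moreover have "s [^] p \<otimes> inv (x [^] p) = \<one> \<longleftrightarrow> s [^] p = x [^] p"
      using s x inv_solve_right'[of \<one> "s [^] p" "x [^] p"] by simp
    ultimately have "s [^] p \<otimes> inv (x [^] p) = \<one> \<longleftrightarrow> s = x" by simp
    moreover have "(\<Sum>\<chi>\<in>characters G. \<chi> (s [^] p) * \<chi> (inv (x [^] p))) =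
        (\<Sum>\<chi>\<in>characters G. \<chi> (s [^] p \<otimes> inv (x [^] p)))"
      using s x by (intro sum.cong refl) (simp add: char_mult)
    ultimately show ?thesis using s x sum_characters[of "s [^] p \<otimes> inv (x [^] p)"]
      by (simp add: card_characters)
  qed
  have "(\<Sum>\<chi>\<in>characters G. (\<Sum>s\<in>carrier G. h s * \<chi> (s [^] p)) * \<chi> (inv (x [^] p))) =
      (\<Sum>s\<in>carrier G. h s * (\<Sum>\<chi>\<in>characters G. \<chi> (s [^] p) * \<chi> (inv (x [^] p))))"
    unfolding sum_distrib_left sum_distrib_right by (subst sum.swap) (simp add: mult.assoc)
  also have "\<dots> = (\<Sum>s\<in>carrier G. if s = x then h s * of_nat (Coset.order G) else 0)"
    using delta by (intro sum.cong refl) simp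
  also have "\<dots> = h x * of_nat (Coset.order G)" using finite_carrier x by simp
  finally have "h x * of_nat (Coset.order G) =
      (\<Sum>\<chi>\<in>characters G. (\<Sum>s\<in>carrier G. h s * \<chi> (s [^] p)) * \<chi> (inv (x [^] p)))"
    by (rule sym)
  also have "\<dots> \<in> cyclotomic_multiples n3 p"
  proof (rule cyclotomic_multiples_sum)
    fix \<chi> assume \<chi>: "\<chi> \<in> characters G"
    have "inv (x [^] p) \<in> carrier G" using x by simp
    then show "(\<Sum>s\<in>carrier G. h s * \<chi> (s [^] p)) * \<chi> (inv (x [^] p)) \<in> cyclotomic_multiples n3 p"
      unfolding h_def
      by (intro cyclotomic_multiples_mult fourier_Frobenius[OF p \<chi> int[OF \<chi>]]
          char_in_cyclotomic_integers[OF \<chi>])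
  qed
  finally have "h x * of_nat (Coset.order G) \<in> cyclotomic_multiples n3 p" .
  moreover have wts: "wt (x [^] p) \<in> weights" "galois3 p (wt x) \<in> weights"
    by (rule cayley_weight_in_weights, rule galois3_weights[OF cayley_weight_in_weights])
  then have "cnj (h x) \<in> cyclotomic_integers n3"
    unfolding h_def complex_cnj_diff using n3_pos
    by (intro cyclotomic_integers_diff weights_in_cyclotomic_integers) auto
  ultimately have "h x * of_nat (Coset.order G) * cnj (h x) \<in> cyclotomic_multiples n3 p"
    by (rule cyclotomic_multiples_mult)
  then obtain g where g: "g \<in> cyclotomic_integers n3"
    "h x * cnj (h x) * of_nat (Coset.order G) = of_nat p * g"
    unfolding cyclotomic_multiples_def by (auto simp: mult_ac)
  have "h x * cnj (h x) \<in> {1, 3}"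
    using weights_diff_norm[OF wts neq] by (simp add: h_def)
  then obtain c :: nat where c: "c \<in> {1, 3}" "h x * cnj (h x) = of_nat c" by force
  have p0: "p > 0" using p(1) prime_gt_0_nat by blast
  have g_eq: "g = of_nat (c * Coset.order G) / of_nat p" using g(2) c(2) p0 by (simp add: field_simps)
  then have "g \<in> \<rat>" by simp
  then have "g \<in> \<int>" using cyclotomic_integers_Rats_imp_Ints[OF n3_pos g(1)] by blast
  then obtain z where z: "g = of_int z" using Ints_cases by blast
  have "of_nat (c * Coset.order G) = (of_nat p * of_int z :: complex)"
    using g_eq z p0 by (simp add: field_simps)
  then have "(of_int (int (c * Coset.order G)) :: complex) = of_int (int p * z)" by simp
  then have "int (c * Coset.order G) = int p * z" by (simp only: of_int_eq_iff)
  then have "int p dvd int (c * Coset.order G)" by simp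
  then have "p dvd c * Coset.order G" by (simp only: int_dvd_int_iff)
  moreover have "c * Coset.order G dvd n3" using c(1) by auto
  ultimately show False using p(2) dvd_trans by blast
qed

lemma equivariant_if_fourier_Ints:
  assumes int: "\<And>\<chi>. \<chi> \<in> characters G \<Longrightarrow> fourier \<chi> \<in> \<int>"
  shows galois_equivariant
  unfolding galois_equivariant_def
proof (intro allI impI ballI)
  fix k s assume "coprime k n3" "s \<in> carrier G"
  then show "wt (s [^] (k::nat)) = galois3 k (wt s)"
  proof (induction k arbitrary: s rule: less_induct)
    case (less k)
    show ?case
    proof (cases "k = 1")
      case True
      then show ?thesis using less.prems by (simp add: galois3_1)
    next
      case False
      then obtain p q where pq: "prime p" "k = p * q" by (metis dvdE prime_factor_nat)
      have cop: "coprime p n3" "coprime q n3" using less.prems(1) unfolding pq(2) by simp_all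
      have "k \<noteq> 0" using coprime_n3D(1)[OF less.prems(1)] by (intro notI) simp
      then have "q < k" using pq prime_gt_1_nat[of p] by simp
      then have IH: "wt (s [^] q) = galois3 q (wt s)" using less.IH cop(2) less.prems(2) by blast
      have "\<not> p dvd n3" using cop(1) pq(1) by (metis coprime_absorb_left not_prime_unit)
      then have "wt ((s [^] q) [^] p) = galois3 p (wt (s [^] q))"
        using equivariant_prime[OF int pq(1)] less.prems(2) by blast
      moreover have "(s [^] q) [^] p = s [^] k"
        using less.prems(2) by (simp add: nat_pow_pow pq(2) mult.commute)
      moreover have "galois3 p (galois3 q (wt s)) = galois3 k (wt s)"
        using galois3_mult coprime_n3D(1) cop pq(2) by metis
      ultimately show ?thesis using IH by metis
    qed
  qed
qed

lemma HS_integral_iff_equivariant: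
  "HS_integral (cayley_mixed_graph G S) \<longleftrightarrow> galois_equivariant"
  using HS_integral_cayley_iff fourier_Ints_if_equivariant equivariant_if_fourier_Ints by blast

end

section \<open>Unions of classes\<close>

context finite_comm_group
begin

lemma Union_in_subgroup_algebra:
  assumes "finite F" "F \<subseteq> subgroup_algebra G"
  shows "\<Union>F \<in> subgroup_algebra G"
  using assms
proof (induction F)
  case empty
  have "carrier G - carrier G \<in> subgroup_algebra G"
    by (intro subgroup_algebra.compl subgroup_algebra.subgroup subgroup_self)
  then show ?case by simp
next
  case (insert A F)
  then show ?case by (simp add: subgroup_algebra.union)
qed

lemma generate_singleton_eq_powers:
  "x \<in> carrier G \<Longrightarrow> generate G {x} = range (\<lambda>k::nat. x [^] k)"
  using generate_pow_on_finite_carrier[OF finite_carrier] by auto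

lemma power_closed_in_subgroup_algebra:
  assumes A: "A \<subseteq> carrier G"
    and pow: "\<And>x k. x \<in> A \<Longrightarrow> coprime k (ord x) \<Longrightarrow> x [^] (k::nat) \<in> A"
  shows "A \<in> subgroup_algebra G"
proof -
  define B where "B x = generate G {x} - (\<Union>y\<in>{y\<in>generate G {x}. x \<notin> generate G {y}}. generate G {y})" for x
  have gen_carr: "generate G {x} \<subseteq> carrier G" if "x \<in> carrier G" for x
    using that by (intro generate_incl) simp
  have gen_alg: "generate G {x} \<in> subgroup_algebra G" if "x \<in> carrier G" for x
    using that by (intro subgroup_algebra.subgroup generate_is_subgroup) simp
  have B_alg: "B x \<in> subgroup_algebra G" if x: "x \<in> carrier G" for x
  proof -
    let ?U = "\<Union>y\<in>{y\<in>generate G {x}. x \<notin> generate G {y}}. generate G {y}"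
    have "?U \<in> subgroup_algebra G"
      using gen_carr[OF x] finite_carrier gen_alg
      by (intro Union_in_subgroup_algebra finite_imageI) (auto intro: finite_subset)
    then have "generate G {x} \<inter> (carrier G - ?U) \<in> subgroup_algebra G"
      by (intro subgroup_algebra.inter subgroup_algebra.compl gen_alg[OF x])
    moreover have "generate G {x} \<inter> (carrier G - ?U) = B x"
      unfolding B_def using gen_carr[OF x] by blast
    ultimately show ?thesis by simp
  qed
  have "A = \<Union>(B ` A)"
  proof (intro subset_antisym subsetI)
    fix x assume x: "x \<in> A"
    then have "x \<in> generate G {x}" by (intro generate.incl) simp
    then have "x \<in> B x" unfolding B_def by blast
    then show "x \<in> \<Union>(B ` A)" using x by blast
  next
    fix z assume "z \<in> \<Union>(B ` A)"
    then obtain x where x: "x \<in> A" "z \<in> B x" by blast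
    have xc: "x \<in> carrier G" using x(1) A by blast
    have z: "z \<in> generate G {x}" using x(2) unfolding B_def by blast
    then have zc: "z \<in> carrier G" using gen_carr[OF xc] by blast
    have "z \<in> generate G {z}" by (intro generate.incl) simp
    then have "x \<in> generate G {z}" using x(2) z unfolding B_def by blast
    then obtain i :: nat where i: "x = z [^] i" using generate_singleton_eq_powers[OF zc] by blast
    obtain j :: nat where j: "z = x [^] j" using z generate_singleton_eq_powers[OF xc] by blast
    have "x [^] int (j * i) = x [^] (1::int)"
      using i unfolding j using xc by (simp only: nat_pow_pow int_pow_int) simp
    then have "int (ord x) dvd 1 - int (j * i)" using int_pow_eq[OF xc] by blast
    then have "coprime (int j) (int (ord x))"
      by (intro coprimeI) (metis dvd_add_right_iff dvd_diff_right_iff dvd_mult2 dvd_trans of_nat_mult diff_add_cancel dvd_diff_commute)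
    then have "coprime j (ord x)" by simp
    then show "z \<in> A" using pow[OF x(1)] j by simp
  qed
  also have "\<dots> \<in> subgroup_algebra G"
    using B_alg A finite_carrier
    by (intro Union_in_subgroup_algebra finite_imageI) (auto intro: finite_subset)
  finally show ?thesis .
qed

lemma subgroup_algebra_pow_iff:
  assumes "A \<in> subgroup_algebra G" "x \<in> carrier G" "coprime k (Coset.order G)"
  shows "x [^] (k::nat) \<in> A \<longleftrightarrow> x \<in> A"
  using assms(1)
proof (induction A)
  case (subgroup H)
  obtain l :: nat where l: "coprime l (Coset.order G)" "[k * l = 1] (mod Coset.order G)"
    "\<And>x. x \<in> carrier G \<Longrightarrow> (x [^] k) [^] l = x"
    by (rule ex_pow_inverse[OF assms(3) dvd_refl order_pos], rule that)
  have closed: "y [^] (m::nat) \<in> H" if "y \<in> H" for y m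
    using that by (induction m) (auto intro: subgroup.m_closed[OF subgroup] subgroup.one_closed[OF subgroup])
  show ?case using closed[of x k] closed[of "x [^] k" l] l(3)[OF assms(2)] by metis
qed (use assms(2) in auto)

end

lemma units_1_mod_3I:
  assumes "m > 0" "3 dvd m" "coprime k m" "[k = 1] (mod 3)"
  shows "k mod m \<in> units_1_mod_3 m"
proof -
  have "[k mod m = k] (mod 3)" using assms(2) by (simp add: cong_def mod_mod_cancel)
  then have 1: "[k mod m = 1] (mod 3)" using assms(4) cong_trans by blast
  then have "k mod m \<noteq> 0" by (intro notI) (simp add: cong_def)
  then have "1 \<le> k mod m" by linarith
  moreover have "k mod m \<le> m - 1" using assms(1) mod_less_divisor[of m k] by linarith
  moreover have "gcd (k mod m) m = 1"
    using assms(1,3) gcd_mod_left[of m k] unfolding coprime_iff_gcd_eq_1 by linarith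
  ultimately show ?thesis using 1 unfolding units_1_mod_3_def by blast
qed

context finite_cayley
begin

lemma ord_pos: "x \<in> carrier G \<Longrightarrow> ord x > 0"
  using ord_ge_1[OF finite_carrier] by fastforce

lemma wt_pow_if_equivariant:
  assumes gal: galois_equivariant and x: "x \<in> carrier G" and k: "coprime k (ord x)"
  shows "wt (x [^] (k::nat)) \<in> {wt x, cnj (wt x)}"
proof -
  obtain k' where k': "[k' = k] (mod ord x)" "coprime k' n3"
    using ex_cong_coprime[OF k n3_pos] by blast
  have "x [^] k = x [^] k'" using k'(1) x by (intro pow_cong) (auto simp: cong_sym)
  then show ?thesis using gal k'(2) x unfolding galois_equivariant_def by (auto simp: galois3_def)
qed

lemma wt_pow_1_mod_3_if_equivariant:
  assumes gal: galois_equivariant and x: "x \<in> carrier G"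
    and k: "coprime k (ord x)" "[k = 1] (mod 3)"
  shows "wt (x [^] (k::nat)) = wt x"
proof -
  have "coprime k (ord x * 3)"
    using k cong_imp_coprime[OF cong_sym[OF k(2)]] by simp
  then obtain k' where k': "[k' = k] (mod ord x * 3)" "coprime k' n3"
    using ex_cong_coprime n3_pos by blast
  have "[k' = k] (mod ord x)" "[k' = k] (mod 3)"
    using k'(1) cong_modulus_mult_nat by (blast, metis cong_modulus_mult_nat mult.commute)
  then have "x [^] k = x [^] k'" "[k' = 1] (mod 3)"
    using x k(2) by (auto intro!: pow_cong simp: cong_sym dest: cong_trans)
  then show ?thesis using gal k'(2) x unfolding galois_equivariant_def by (simp add: galois3_def)
qed

lemma symmetric_part_if_equivariant:
  assumes gal: galois_equivariant
  shows "S - skew_part G S \<in> subgroup_algebra G"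
proof (rule power_closed_in_subgroup_algebra)
  show "S - skew_part G S \<subseteq> carrier G" using S_closed by blast
  fix x k assume x: "x \<in> S - skew_part G S" and k: "coprime k (ord x)"
  then have "wt x = 1" by (simp add: cayley_weight_eq_1_iff)
  moreover have "x \<in> carrier G" using x S_closed by blast
  ultimately have "wt (x [^] k) = 1"
    using wt_pow_if_equivariant[OF gal _ k] by simp
  then show "x [^] (k::nat) \<in> S - skew_part G S" by (simp only: cayley_weight_eq_1_iff)
qed

lemma skew_part_order_if_equivariant:
  assumes gal: galois_equivariant and x: "x \<in> skew_part G S"
  shows "3 dvd ord x"
proof (rule ccontr)
  define m where "m = ord x"
  assume "\<not> 3 dvd ord x"
  then have m3: "m mod 3 = 1 \<or> m mod 3 = 2" unfolding m_def by presburger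
  have xc: "x \<in> carrier G" using x S_closed unfolding skew_part_def by blast
  have m: "m > 0" unfolding m_def using ord_pos[OF xc] .
  \<comment> \<open>\<open>k \<equiv> 1 (mod 3)\<close> because \<open>m\<^sup>2 \<equiv> 1 (mod 3)\<close>, while \<open>k \<equiv> -1 (mod m)\<close>\<close>
  define q where "q = m * m"
  define k where "k = 2 * q - 1"
  have k: "k + 1 = 2 * q" unfolding k_def q_def using m by simp
  have "q mod 3 = (m mod 3) * (m mod 3) mod 3" unfolding q_def by (simp add: mod_mult_eq)
  also have "\<dots> = 1" using m3 by auto
  finally have "k = 3 * (2 * (q div 3)) + 1" using k div_mult_mod_eq[of q 3] by linarith
  then have k1: "[k = 1] (mod 3)" unfolding cong_def by (metis mod_mult_self4)
  have "coprime k (k + 1)" by simp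
  then have "coprime k m" unfolding k q_def by simp
  then have wtk: "wt (x [^] k) = wt x"
    using wt_pow_1_mod_3_if_equivariant[OF gal xc _ k1] unfolding m_def by blast
  have "x [^] (k + 1) = (x [^] m) [^] (2 * m)" unfolding k q_def using xc by (simp add: nat_pow_pow mult_ac)
  then have "x [^] k \<otimes> x = \<one>" using xc unfolding m_def by simp
  then have "x [^] k = inv x" using xc by (simp add: inv_equality)
  then have "cnj (wt x) = wt x" using wtk wt_inv[OF xc] by simp
  then show False using x weight6_nonreal(1) by (simp add: cayley_weight_eq_weight6_iff[symmetric])
qed

lemma skew_part_if_equivariant:
  assumes gal: galois_equivariant
  shows "skew_part G S \<in> skew_class_unions G"
proof -
  have sub: "skew_part G S \<subseteq> elements_order_dvd3 G"
    using skew_part_order_if_equivariant[OF gal] S_closed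
    by (auto simp: elements_order_dvd3_def skew_part_def)
  show ?thesis
  proof (cases "elements_order_dvd3 G = {}")
    case True
    then show ?thesis using sub by (simp add: skew_class_unions_def)
  next
    case False
    have "skew_part G S = (\<Union>x\<in>skew_part G S. class3 G x)"
    proof (intro subset_antisym subsetI)
      fix x assume x: "x \<in> skew_part G S"
      then have xc: "x \<in> carrier G" "3 dvd ord x" using sub by (auto simp: elements_order_dvd3_def)
      then have "ord x \<ge> 3" using ord_pos dvd_imp_le by blast
      then have "1 \<in> units_1_mod_3 (ord x)" by (simp add: units_1_mod_3_def)
      moreover have "x = x [^] (1::nat)" using xc by simp
      ultimately have "x \<in> class3 G x" unfolding class3_def by blast
      then show "x \<in> (\<Union>x\<in>skew_part G S. class3 G x)" using x by blast
    next
      fix z assume "z \<in> (\<Union>x\<in>skew_part G S. class3 G x)"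
      then obtain x k where x: "x \<in> skew_part G S" "k \<in> units_1_mod_3 (ord x)" "z = x [^] k"
        unfolding class3_def by blast
      have "x \<in> carrier G" using x(1) sub by (auto simp: elements_order_dvd3_def)
      moreover have "coprime k (ord x)" "[k = 1] (mod 3)"
        using x(2) unfolding units_1_mod_3_def coprime_iff_gcd_eq_1 by blast+
      ultimately have "wt z = wt x" unfolding x(3) by (rule wt_pow_1_mod_3_if_equivariant[OF gal])
      then show "z \<in> skew_part G S" using x(1) by (simp add: cayley_weight_eq_weight6_iff[symmetric])
    qed
    moreover have "skew_symmetric G (skew_part G S)"
      by (auto simp: skew_symmetric_def skew_part_def)
    moreover have "finite (skew_part G S)"
      using finite_carrier S_closed by (auto simp: skew_part_def intro: finite_subset)
    ultimately show ?thesis using sub False unfolding skew_class_unions_def by auto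
  qed
qed

lemma class_union_pow_closed:
  assumes A: "A \<in> skew_class_unions G" and y: "y \<in> A"
    and k: "coprime k (Coset.order G)" "[k = 1] (mod 3)"
  shows "y [^] (k::nat) \<in> A"
proof -
  obtain X where X: "X \<subseteq> elements_order_dvd3 G" "A = (\<Union>x\<in>X. class3 G x)"
    using A y by (auto simp: skew_class_unions_def split: if_splits)
  then obtain x j where x: "x \<in> X" "j \<in> units_1_mod_3 (ord x)" "y = x [^] j"
    using y unfolding class3_def by blast
  have xc: "x \<in> carrier G" "3 dvd ord x" using x(1) X(1) by (auto simp: elements_order_dvd3_def)
  have j: "coprime j (ord x)" "[j = 1] (mod 3)"
    using x(2) unfolding units_1_mod_3_def coprime_iff_gcd_eq_1 by blast+
  have "coprime k (ord x)" using k(1) ord_dvd_group_order[OF xc(1)] coprime_divisors dvd_refl by blast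
  then have "coprime (j * k) (ord x)" using j(1) by simp
  moreover have "[j * k = 1 * 1] (mod 3)" using j(2) k(2) by (rule cong_mult)
  ultimately have "(j * k) mod ord x \<in> units_1_mod_3 (ord x)"
    using units_1_mod_3I[OF ord_pos[OF xc(1)] xc(2)] by simp
  moreover have "y [^] k = x [^] (j * k mod ord x)"
    unfolding x(3) nat_pow_pow[OF xc(1)] by (rule pow_cong[OF xc(1)]) (simp add: cong_def)
  ultimately have "y [^] k \<in> class3 G x" unfolding class3_def by blast
  then show ?thesis using x(1) X(2) by blast
qed

lemma equivariant_if_parts:
  assumes sym: "S - skew_part G S \<in> subgroup_algebra G" and skew: "skew_part G S \<in> skew_class_unions G"
  shows galois_equivariant
proof -
  have inv_pow: "inv s [^] k = inv (s [^] k)" if "s \<in> carrier G" for s and k :: nat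
    using that by (simp add: nat_pow_inv)
  have nz: "wt (s [^] k) = wt s"
    if k: "coprime k n3" "[k = 1] (mod 3)" and s: "s \<in> carrier G" "wt s \<noteq> 0" for k :: nat and s
  proof -
    have cop: "coprime k (Coset.order G)" using coprime_n3D(2)[OF k(1)] .
    have w6: "wt (t [^] k) = weight6" if "t \<in> carrier G" "wt t = weight6" for t
      using class_union_pow_closed[OF skew _ cop k(2)] that by (simp add: cayley_weight_eq_weight6_iff)
    consider "wt s = 1" | "wt s = weight6" | "wt s = cnj weight6"
      using s(2) cayley_weight_in_weights[of G S s] by blast
    then show ?thesis
    proof cases
      case 1
      then have "wt (s [^] k) = 1"
        using subgroup_algebra_pow_iff[OF sym s(1) cop] by (simp only: cayley_weight_eq_1_iff)
      then show ?thesis using 1 by simp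
    next
      case 2
      then show ?thesis using w6[OF s(1)] by simp
    next
      case 3
      then have "wt (inv s) = weight6" using wt_inv[OF s(1)] by simp
      then have "wt (inv (s [^] k)) = weight6" using w6[of "inv s"] s(1) by (simp add: inv_pow)
      then show ?thesis using 3 wt_inv[of "s [^] k"] s(1) by (metis complex_cnj_cnj nat_pow_closed)
    qed
  qed
  have one: "wt (s [^] k) = wt s"
    if k: "coprime k n3" "[k = 1] (mod 3)" and s: "s \<in> carrier G" for k :: nat and s
  proof (cases "wt s = 0")
    case True
    obtain l :: nat where l: "coprime l n3" "[k * l = 1] (mod n3)"
      "\<And>x. x \<in> carrier G \<Longrightarrow> (x [^] k) [^] l = x"
      by (rule ex_pow_inverse[OF k(1) dvd_triv_right n3_pos], rule that)
    have "[k * l = 1] (mod 3)" using l(2) cong_modulus_mult_nat by blast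
    moreover have "[k * l = 1 * l] (mod 3)" using k(2) by (rule cong_mult) simp
    ultimately have "[l = 1] (mod 3)" by (metis cong_sym cong_trans mult_1)
    then have "wt (s [^] k) \<noteq> 0 \<Longrightarrow> wt s = wt (s [^] k)"
      using nz[OF l(1), of "s [^] k"] l(3)[OF s] s by simp
    then show ?thesis using True by auto
  next
    case False
    then show ?thesis using nz k s by blast
  qed
  show ?thesis
    unfolding galois_equivariant_def
  proof (intro allI impI ballI)
    fix k s assume k: "coprime (k::nat) n3" and s: "s \<in> carrier G"
    show "wt (s [^] k) = galois3 k (wt s)"
    proof (cases "[k = 1] (mod 3)")
      case True
      then show ?thesis using one k s by (simp add: galois3_def)
    next
      case False
      \<comment> \<open>\<open>l \<equiv> -k\<close> modulo both 3 and the group order\<close>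
      define l where "l = k * (n3 - 1)"
      have lk: "l + k = k * n3" unfolding l_def using n3_pos by (simp add: algebra_simps)
      have "coprime (n3 - 1) n3" using n3_pos coprime_diff_one_left_nat by blast
      then have l: "coprime l n3" unfolding l_def using k by (simp only: coprime_mult_left_iff)
      have "k mod 3 = 2" using False coprime_n3D(1)[OF k] unfolding cong_def by presburger
      moreover have "(l + k) mod 3 = 0" unfolding lk by simp
      ultimately have l1: "[l = 1] (mod 3)" unfolding cong_def by presburger
      have "s [^] k \<otimes> s [^] l = s [^] (Coset.order G * (3 * k))"
        using s lk by (simp add: nat_pow_mult mult_ac add.commute)
      also have "\<dots> = \<one>" using s by (simp only: nat_pow_pow[symmetric] pow_order_eq_1 nat_pow_one)
      finally have "inv (s [^] l) = s [^] k" using s by (intro inv_equality) auto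
      then have "wt (s [^] k) = cnj (wt (s [^] l))" using wt_inv[of "s [^] l"] s by simp
      also have "\<dots> = cnj (wt s)" using one[OF l l1 s] by simp
      finally show ?thesis using False by (simp add: galois3_def)
    qed
  qed
qed

end

theorem theorem4p7:
  fixes G :: "('a, 'b) monoid_scheme" and S :: "'a set"
  assumes "comm_group G"
    and "finite (carrier G)"
    and "S \<subseteq> carrier G"
    and "\<one>\<^bsub>G\<^esub> \<notin> S"
  shows "HS_integral (cayley_mixed_graph G S) \<longleftrightarrow>
    S - skew_part G S \<in> subgroup_algebra G \<and> skew_part G S \<in> skew_class_unions G"
proof -
  interpret comm_group G by (rule assms(1))
  interpret finite_cayley G S by unfold_locales (rule assms(2), rule assms(3))
  show ?thesis
    unfolding HS_integral_iff_equivariant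
    by (intro iffI conjI symmetric_part_if_equivariant skew_part_if_equivariant)
       (auto intro: equivariant_if_parts)
qed

end
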